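(* Let $m\le n$, let $Q\in\mathbb{R}^{n\times n}$ be symmetric positive semidefinite, let $A\in\mathbb{R}^{m\times n}$ have full rank, let $\Theta^{(1)}\in\mathbb{R}^{n\times n}$ be diagonal positive definite, and let $\Theta^{(2)}\in\mathbb{R}^{m\times m}$ be diagonal positive semidefinite with $\Theta^{(2)}\neq 0$. Let $\mathcal{L}=\{i:\Theta^{(2)}_{ii}\neq 0\}$ and let $m_1$ be its cardinality. Let $G=\mathrm{diag}(Q+\Theta^{(1)})$ and $S=AG^{-1}A^T+\Theta^{(2)}$. Let $J\in\mathbb{R}^{n\times n}$ be diagonal positive definite, let $\Theta^{(2)}_{upd}\in\mathbb{R}^{m\times m}$ be diagonal positive semidefinite with $\{i:(\Theta^{(2)}_{upd})_{ii}\neq 0\}=\mathcal{L}$, and let $S_{upd}=AJ^{-1}A^T+\Theta^{(2)}_{upd}$. Set $$\mathcal{A}=\begin{bmatrix} Q+\Theta^{(1)} & A^T\\ A & -\Theta^{(2)}\end{bmatrix},\qquad \mathcal{P}_{upd}=\begin{bmatrix} I_n & 0\\ AG^{-1} & I_m\end{bmatrix}\begin{bmatrix} G & 0\\ 0 & -S_{upd}\end{bmatrix}\begin{bmatrix} I_n & G^{-1}A^T\\ 0 & I_m\end{bmatrix}.$$ Let $\tilde\Theta^{(2)}$ and $\tilde\Theta^{(2)}_{upd}$ be the $m_1\times m_1$ diagonal submatrices of $\Theta^{(2)}$ and $\Theta^{(2)}_{upd}$ with row and column indices in $\mathcal{L}$, let $\tilde G$ and $\tilde J$ be the $(n+m_1)\times(n+m_1)$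 diagonal matrices defined by $$\tilde G^{-1}=\begin{bmatrix} G^{-1} & 0\\ 0 & \tilde\Theta^{(2)}\end{bmatrix},\qquad \tilde J^{-1}=\begin{bmatrix} J^{-1} & 0\\ 0 & \tilde\Theta^{(2)}_{upd}\end{bmatrix},$$ and let $\gamma_1(\tilde J)$ and $\gamma_{n+m_1}(\tilde J)$ be the smallest and the largest diagonal entry of $\tilde J\tilde G^{-1}$, respectively. Let $X=G^{-\frac12}(Q+\Theta^{(1)})G^{-\frac12}$ and suppose that $2I_n-X$ is positive definite. Define $$\bar\lambda=\lambda_{\max}(S_{upd}^{-1}S)\,\max\{2-\lambda_{\min}(X),\,1\},\qquad \underline{\lambda}=\lambda_{\min}(S_{upd}^{-1}S)\,\min\{2-\lambda_{\max}(X),\,1\}.$$ Let $\lambda$ be an eigenvalue of $\mathcal{P}_{upd}^{-1}\mathcal{A}$ with corresponding eigenvector $[x^T,y^T]^T$ (with $x$ of length $n$ and $y$ of length $m$). If $\lambda$ has nonzero imaginary part, then $$\tfrac12\left(\lambda_{\min}(X)+\underline{\lambda}\right)\le\mathcal{R}(\lambda)\le\tfrac12\left(\lambda_{\max}(X)+\bar\lambda\right);$$ otherwise $$\min\{\lambda_{\min}(X),\,\underline{\lambda}\}\le\lambda\le\max\{\lambda_{\max}(X),\,\bar\lambda\}\quad\text{for } y\neq 0,$$ $$\lambda_{\min}(X)\le\lambda\le\lambda_{\max}(X)\quad\text{for } y=0;$$ and here $$\bar\lambda\le\gamma_{n+m_1}(\tilde J)\,\max\{2-\lambda_{\min}(X),\,1\},\qquad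 \underline{\lambda}\ge\gamma_1(\tilde J)\,\min\{2-\lambda_{\max}(X),\,1\}.$$ Furthermore, $$|\mathcal{I}(\lambda)|\le\sqrt{\gamma_{n+m_1}(\tilde J)}\;\|I_n-X\|.$$
   Context: $\mathrm{diag}(M)$ denotes the diagonal matrix with the same diagonal entries as $M$. $I_r$ is the $r\times r$ identity matrix. $\|\cdot\|$ is the vector or matrix 2-norm. $\lambda_{\min}(\cdot)$ and $\lambda_{\max}(\cdot)$ denote the minimum and maximum eigenvalues of a matrix with real eigenvalues (symmetric matrices, and products such as $S_{upd}^{-1}S$, which are similar to symmetric matrices). $\mathcal{R}(\alpha)$ and $\mathcal{I}(\alpha)$ denote the real and imaginary parts of a complex number $\alpha$. Eigenvalues and eigenvectors of $\mathcal{P}_{upd}^{-1}\mathcal{A}$ may be complex. *)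

theory Defs
  imports
    Complex_Main
    "Jordan_Normal_Form.Matrix"
    "Jordan_Normal_Form.Gauss_Jordan_Elimination"
    "Jordan_Normal_Form.Spectral_Radius"
    "Jordan_Normal_Form.DL_Rank"
    "Jordan_Normal_Form.DL_Submatrix"
begin

definition sym_psd :: "nat \<Rightarrow> real mat \<Rightarrow> bool" where
  "sym_psd n M \<longleftrightarrow> M \<in> carrier_mat n n \<and> transpose_mat M = M \<and>
     (\<forall>v \<in> carrier_vec n. 0 \<le> v \<bullet> (M *\<^sub>v v))"

definition sym_pd :: "nat \<Rightarrow> real mat \<Rightarrow> bool" where
  "sym_pd n M \<longleftrightarrow> M \<in> carrier_mat n n \<and> transpose_mat M = M \<and>
     (\<forall>v \<in> carrier_vec n. v \<noteq> 0\<^sub>v n \<longrightarrow> 0 < v \<bullet> (M *\<^sub>v v))"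

text \<open>Unspecified if the matrix is singular.\<close>

abbreviation mat_inv :: "'a :: field mat \<Rightarrow> 'a mat" where
  "mat_inv M \<equiv> the (mat_inverse M)"

definition diag_part :: "'a :: zero mat \<Rightarrow> 'a mat" where
  "diag_part M = mat_diag (dim_row M) (\<lambda>i. M $$ (i, i))"

text \<open>The power with exponent -1/2; meant only for diagonal matrices with positive diagonal.\<close>

definition diag_inv_sqrt :: "real mat \<Rightarrow> real mat" where
  "diag_inv_sqrt D = mat_diag (dim_row D) (\<lambda>i. 1 / sqrt (D $$ (i, i)))"

text \<open>The spectrum over the reals, so meant only for matrices all of whose complex eigenvalues
  are real. Such a matrix of positive dimension has a finite nonempty real spectrum.\<close>

definition lambda_min :: "real mat \<Rightarrow> real" where
  "lambda_min M = Min (spectrum M)"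

definition lambda_max :: "real mat \<Rightarrow> real" where
  "lambda_max M = Max (spectrum M)"

definition vec_norm2 :: "real vec \<Rightarrow> real" where
  "vec_norm2 v = sqrt (v \<bullet> v)"

definition mat_norm2 :: "real mat \<Rightarrow> real" where
  "mat_norm2 M = (SUP v \<in> {v \<in> carrier_vec (dim_col M). vec_norm2 v = 1}. vec_norm2 (M *\<^sub>v v))"

definition min_diag :: "real mat \<Rightarrow> real" where
  "min_diag M = Min (set (diag_mat M))"

definition max_diag :: "real mat \<Rightarrow> real" where
  "max_diag M = Max (set (diag_mat M))"

end

theory Submission
  imports Defs
begin

text \<open>
  Put \<open>k = G\<^sup>-\<^sup>1 A\<^sup>T y\<close> and \<open>w = x + k\<close>. Pairing the two block rows of
  \<open>\<A> z = \<lambda> P z\<close> with \<open>(w, 0)\<close> and \<open>(k, -y)\<close> gives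
  \<open>h - c = \<lambda> g\<close> and \<open>c\<^sup>* + t = \<lambda> s\<close>, where \<open>g = w\<^sup>* G w\<close>, \<open>h = w\<^sup>* (Q + \<Theta>\<^sub>1) w\<close>,
  \<open>s = y\<^sup>* S\<^sub>u\<^sub>p\<^sub>d y\<close>, \<open>t = 2 k\<^sup>* G k - k\<^sup>* (Q + \<Theta>\<^sub>1) k + y\<^sup>* \<Theta>\<^sub>2 y\<close> and
  \<open>c = w\<^sup>* (Q + \<Theta>\<^sub>1 - G) k\<close>. Hence \<open>Re \<lambda> (g + s) = h + t\<close> and \<open>Im \<lambda> g = Im \<lambda> s = - Im c\<close>: a nonreal eigenvalue
  has \<open>g = s\<close>, so its real part is the mean of the two Rayleigh quotients \<open>h / g\<close> and \<open>t / s\<close>, a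
  real one is a weighted mean of them, and \<open>Im \<lambda>\<close> is bounded by Cauchy-Schwarz applied to \<open>c\<close>.
\<close>

subsection \<open>Symmetric pencils\<close>

text \<open>In the coordinates \<open>(w, y)\<close> the preconditioner has the indefinite form
  \<open>g - s\<close>, so ordinary Rayleigh quotients of the preconditioned matrix give no bounds.
  The sign flip in the test vector \<open>(k, -y)\<close> trades \<open>g - s\<close> for
  \<open>g + s\<close>, which is positive. The constants come from \<open>t\<close>. With
  \<open>r = k\<^sup>* G k\<close> and \<open>\<theta> = y\<^sup>* \<Theta>\<^sub>2 y\<close> one
  has \<open>y\<^sup>* S y = r + \<theta>\<close>. In \<open>t\<close> the part \<open>r\<close> is
  weighted by 2 minus a Rayleigh quotient of \<open>X\<close>, the part \<open>\<theta>\<close> by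
  1; hence the maximum and minimum with 1. What remains, \<open>y\<^sup>* S y / s\<close>, is a
  Rayleigh quotient of the pencil formed by \<open>S\<close> and
  \<open>S\<^sub>u\<^sub>p\<^sub>d\<close>. The square root in the imaginary bound stems from
  \<open>k\<^sup>* G k \<le> y\<^sup>* S y \<le> \<gamma> s\<close>. Extremal eigenvalues are
  defined through the real spectrum, so it has to be shown that they are attained and bound the
  Rayleigh quotients. One statement about symmetric definite pencils does this both for the
  symmetric \<open>X\<close> and for the nonsymmetric
  \<open>S\<^sub>u\<^sub>p\<^sub>d\<^sup>-\<^sup>1 S\<close>.\<close>

lemma smult_mat_mult_vec:
  fixes M :: "'a :: comm_ring_1 mat"
  assumes "M \<in> carrier_mat nr nc" "v \<in> carrier_vec nc"
  shows "(a \<cdot>\<^sub>m M) *\<^sub>v v = a \<cdot>\<^sub>v (M *\<^sub>v v)"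
  using assms by (intro eq_vecI) auto

lemma transpose_mat_smult: "(a \<cdot>\<^sub>m M)\<^sup>T = a \<cdot>\<^sub>m M\<^sup>T"
  by (rule eq_matI) auto

lemma scalar_prod_self_sum: "v \<bullet> v = (\<Sum>i<dim_vec v. (v $ i)\<^sup>2)" for v :: "real vec"
  by (simp add: scalar_prod_def power2_eq_square atLeast0LessThan)

lemma scalar_prod_self_nonneg: "0 \<le> v \<bullet> v" for v :: "real vec"
  by (simp add: scalar_prod_self_sum sum_nonneg)

lemma scalar_prod_self_pos:
  fixes v :: "real vec"
  assumes "v \<in> carrier_vec n" "v \<noteq> 0\<^sub>v n"
  shows "0 < v \<bullet> v"
proof -
  obtain i where "i < n" "v $ i \<noteq> 0"
    using assms by (metis carrier_vecD eq_vecI index_zero_vec)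
  then have "0 < (v $ i)\<^sup>2" by simp
  also have "\<dots> \<le> (\<Sum>i<dim_vec v. (v $ i)\<^sup>2)"
    using \<open>i < n\<close> assms(1) by (intro member_le_sum) auto
  finally show ?thesis by (simp add: scalar_prod_self_sum)
qed

lemma vec_norm2_square: "(vec_norm2 v)\<^sup>2 = v \<bullet> v"
  by (simp add: vec_norm2_def scalar_prod_self_nonneg)

lemma vec_norm2_nonneg: "0 \<le> vec_norm2 v"
  by (simp add: vec_norm2_def scalar_prod_self_nonneg)

lemma symmetric_form_commute:
  fixes M :: "'a :: comm_ring mat"
  assumes "M \<in> carrier_mat n n" "M\<^sup>T = M" "u \<in> carrier_vec n" "v \<in> carrier_vec n"
  shows "u \<bullet> (M *\<^sub>v v) = v \<bullet> (M *\<^sub>v u)"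
  using transpose_vec_mult_scalar[OF assms(1,4,3)] assms
  by (metis comm_scalar_prod mult_mat_vec_carrier)

lemma form_add_smult:
  fixes M :: "real mat"
  assumes "M \<in> carrier_mat n n" "M\<^sup>T = M" "u \<in> carrier_vec n" "v \<in> carrier_vec n"
  shows "(u + t \<cdot>\<^sub>v v) \<bullet> (M *\<^sub>v (u + t \<cdot>\<^sub>v v)) =
    u \<bullet> (M *\<^sub>v u) + 2 * t * (u \<bullet> (M *\<^sub>v v)) + t\<^sup>2 * (v \<bullet> (M *\<^sub>v v))"
proof -
  have c: "M *\<^sub>v u \<in> carrier_vec n" "M *\<^sub>v v \<in> carrier_vec n" "t \<cdot>\<^sub>v v \<in> carrier_vec n"
    using assms by auto
  have "v \<bullet> (M *\<^sub>v u) = u \<bullet> (M *\<^sub>v v)"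
    using assms by (intro symmetric_form_commute)
  with assms c show ?thesis
    by (simp add: mult_add_distrib_mat_vec[OF assms(1)] mult_mat_vec[OF assms(1)]
        add_scalar_prod_distrib[of _ n] scalar_prod_add_distrib[of _ n]
        smult_scalar_prod_distrib[of _ n] scalar_prod_smult_distrib[of _ n]
        algebra_simps power2_eq_square)
qed

lemma quadratic_nonneg_discriminant:
  fixes a b c :: real
  assumes "\<And>t. 0 \<le> a + 2 * t * b + t\<^sup>2 * c" "0 \<le> c"
  shows "b\<^sup>2 \<le> a * c"
proof (cases "c = 0")
  case True
  have "b = 0"
  proof (rule ccontr)
    assume "b \<noteq> 0"
    \<comment> \<open>At this \<open>t\<close> the affine function \<open>a + 2 * t * b\<close>
      takes the value \<open>a - (a + 1) = -1\<close>.\<close>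
    then show False using assms(1)[of "- (a + 1) / (2 * b)"] True by (simp add: field_simps)
  qed
  with True show ?thesis by simp
next
  case False
  with assms(2) have c: "c > 0" by simp
  have "0 \<le> a + 2 * (- b / c) * b + (- b / c)\<^sup>2 * c" by (rule assms)
  also have "\<dots> = a - b\<^sup>2 / c" using c by (simp add: field_simps power2_eq_square)
  finally show ?thesis using c by (simp add: field_simps)
qed

lemma psd_form_Cauchy_Schwarz:
  assumes "sym_psd n M" "u \<in> carrier_vec n" "v \<in> carrier_vec n"
  shows "(u \<bullet> (M *\<^sub>v v))\<^sup>2 \<le> (u \<bullet> (M *\<^sub>v u)) * (v \<bullet> (M *\<^sub>v v))"
proof (rule quadratic_nonneg_discriminant)
  fix t
  have "0 \<le> (u + t \<cdot>\<^sub>v v) \<bullet> (M *\<^sub>v (u + t \<cdot>\<^sub>v v))"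
    using assms by (auto simp: sym_psd_def)
  then show "0 \<le> u \<bullet> (M *\<^sub>v u) + 2 * t * (u \<bullet> (M *\<^sub>v v)) + t\<^sup>2 * (v \<bullet> (M *\<^sub>v v))"
    using assms form_add_smult[of M n u v t] by (simp add: sym_psd_def)
qed (use assms in \<open>simp add: sym_psd_def\<close>)

lemma sym_psd_one: "sym_psd n (1\<^sub>m n)"
  by (simp add: sym_psd_def scalar_prod_self_nonneg)

lemma sym_pd_imp_psd: "sym_pd n M \<Longrightarrow> sym_psd n M"
  unfolding sym_pd_def sym_psd_def
  by (metis less_eq_real_def mult_mat_vec_carrier scalar_prod_left_zero)

lemma scalar_prod_Cauchy_Schwarz:
  assumes "u \<in> carrier_vec n" "v \<in> carrier_vec n"
  shows "\<bar>u \<bullet> v\<bar> \<le> vec_norm2 u * vec_norm2 v"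
  using real_sqrt_le_mono[OF psd_form_Cauchy_Schwarz[OF sym_psd_one assms]] assms
  by (simp add: vec_norm2_def real_sqrt_mult)

text \<open>Each product of two entries of \<open>v\<close> is at most \<open>v \<bullet> v\<close>,
  so the sum of the absolute entries of \<open>K\<close> serves as a bound; adding 1 makes it
  strictly positive, and later it may be divided by. No symmetry is assumed, since \<open>K\<close>
  will also be an inverse.\<close>

lemma form_bounded:
  fixes K :: "real mat"
  assumes K: "K \<in> carrier_mat n n"
  shows "\<exists>C>0. \<forall>v\<in>carrier_vec n. v \<bullet> (K *\<^sub>v v) \<le> C * (v \<bullet> v)"
proof -
  define C where "C = (\<Sum>i<n. \<Sum>j<n. \<bar>K $$ (i, j)\<bar>)"
  have "v \<bullet> (K *\<^sub>v v) \<le> (C + 1) * (v \<bullet> v)" if v: "v \<in> carrier_vec n" for v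
  proof -
    have le: "\<bar>v $ i * v $ j\<bar> \<le> v \<bullet> v" if "i < n" "j < n" for i j
    proof -
      have sq: "(v $ i)\<^sup>2 \<le> v \<bullet> v" if "i < n" for i
        unfolding scalar_prod_self_sum using that v by (intro member_le_sum) auto
      have "\<bar>v $ i * v $ j\<bar>\<^sup>2 = (v $ i)\<^sup>2 * (v $ j)\<^sup>2" by (simp add: power_mult_distrib)
      also have "\<dots> \<le> (v \<bullet> v) * (v \<bullet> v)"
        using sq that scalar_prod_self_nonneg by (intro mult_mono) auto
      finally show ?thesis
        using scalar_prod_self_nonneg[of v] by (metis power2_eq_square power2_le_imp_le)
    qed
    have "v \<bullet> (K *\<^sub>v v) = (\<Sum>i<n. \<Sum>j<n. K $$ (i, j) * (v $ i * v $ j))"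
      using v K
      by (simp add: scalar_prod_def sum_distrib_left atLeast0LessThan mult_ac)
    also have "\<dots> \<le> (\<Sum>i<n. \<Sum>j<n. \<bar>K $$ (i, j)\<bar> * (v \<bullet> v))"
    proof (intro sum_mono)
      fix i j assume "i \<in> {..<n}" "j \<in> {..<n}"
      then have "\<bar>K $$ (i, j) * (v $ i * v $ j)\<bar> \<le> \<bar>K $$ (i, j)\<bar> * (v \<bullet> v)"
        unfolding abs_mult[of "K $$ (i, j)"] using le by (intro mult_left_mono) auto
      then show "K $$ (i, j) * (v $ i * v $ j) \<le> \<bar>K $$ (i, j)\<bar> * (v \<bullet> v)" by linarith
    qed
    also have "\<dots> = C * (v \<bullet> v)" by (simp add: C_def sum_distrib_right)
    also have "\<dots> \<le> (C + 1) * (v \<bullet> v)"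
      using scalar_prod_self_nonneg by (intro mult_right_mono) auto
    finally show ?thesis .
  qed
  moreover have "C + 1 > 0" unfolding C_def by (intro add_nonneg_pos sum_nonneg) auto
  ultimately show ?thesis by blast
qed

lemma det_nonzero_inverse:
  fixes M :: "'a :: field mat"
  assumes "M \<in> carrier_mat n n" "det M \<noteq> 0"
  obtains R where "R \<in> carrier_mat n n" "R * M = 1\<^sub>m n" "M * R = 1\<^sub>m n"
  using det_non_zero_imp_unit[OF assms, of "()"]
  by (auto simp: Units_def ring_mat_def)

text \<open>With \<open>M u = v\<close>, Cauchy-Schwarz gives
  \<open>(v \<bullet> v)\<^sup>2 = (v \<bullet> M u)\<^sup>2 \<le> (v \<bullet> M v) (v \<bullet> u)\<close>, and \<open>v \<bullet> u\<close> is at most a multiple of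
  \<open>v \<bullet> v\<close>; no compactness is needed.\<close>

lemma psd_nonsingular_coercive:
  assumes M: "sym_psd n M" and det: "det M \<noteq> 0"
  shows "\<exists>C>0. \<forall>v\<in>carrier_vec n. v \<bullet> v \<le> C * (v \<bullet> (M *\<^sub>v v))"
proof -
  have Mc: "M \<in> carrier_mat n n" using M by (simp add: sym_psd_def)
  obtain R where R: "R \<in> carrier_mat n n" "M * R = 1\<^sub>m n"
    using det_nonzero_inverse[OF Mc det] by metis
  obtain C where C: "C > 0" "\<And>v. v \<in> carrier_vec n \<Longrightarrow> v \<bullet> (R *\<^sub>v v) \<le> C * (v \<bullet> v)"
    using form_bounded[OF R(1)] by blast
  have "v \<bullet> v \<le> C * (v \<bullet> (M *\<^sub>v v))" if v: "v \<in> carrier_vec n" for v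
  proof (cases "v = 0\<^sub>v n")
    case True
    with Mc show ?thesis by simp
  next
    case False
    define u where "u = R *\<^sub>v v"
    have u: "u \<in> carrier_vec n" using R v by (simp add: u_def)
    have Mu: "M *\<^sub>v u = v"
      using R v Mc by (simp add: u_def assoc_mult_mat_vec[symmetric])
    have pos: "0 < v \<bullet> v" by (rule scalar_prod_self_pos[OF v False])
    have nn: "0 \<le> v \<bullet> (M *\<^sub>v v)" using M v by (simp add: sym_psd_def)
    have "(v \<bullet> v) * (v \<bullet> v) \<le> (v \<bullet> (M *\<^sub>v v)) * (u \<bullet> v)"
      using psd_form_Cauchy_Schwarz[OF M v u] by (simp add: Mu power2_eq_square)
    also have "\<dots> \<le> (v \<bullet> (M *\<^sub>v v)) * (C * (v \<bullet> v))"
      using C(2)[OF v] nn comm_scalar_prod[OF u v] by (intro mult_left_mono) (auto simp: u_def)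
    finally have "(v \<bullet> v) * (v \<bullet> v) \<le> (C * (v \<bullet> (M *\<^sub>v v))) * (v \<bullet> v)" by (simp add: mult_ac)
    with pos show ?thesis by simp
  qed
  with C(1) show ?thesis by blast
qed

section \<open>Extremal eigenvalues of symmetric definite pencils\<close>

lemma sym_pd_det_nonzero:
  assumes "sym_pd n M"
  shows "det M \<noteq> 0"
proof
  assume "det M = 0"
  with assms obtain v where "v \<in> carrier_vec n" "v \<noteq> 0\<^sub>v n" "M *\<^sub>v v = 0\<^sub>v n"
    using det_0_iff_vec_prod_zero_field[of M n] by (auto simp: sym_pd_def)
  with assms show False by (force simp: sym_pd_def)
qed

text \<open>Take \<open>\<mu>\<close> as the infimum of the Rayleigh quotients. Then
  \<open>M - \<mu> N\<close> is positive semidefinite; were it nonsingular, coercivity would leave a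
  gap above \<open>\<mu>\<close>. So it is singular, and a kernel vector attains the infimum. This
  replaces both the spectral theorem and a compactness argument.\<close>

lemma pencil_minimum:
  assumes n: "0 < n" and M: "M \<in> carrier_mat n n" "M\<^sup>T = M" and N: "sym_pd n N"
  shows "\<exists>\<mu> v. v \<in> carrier_vec n \<and> v \<noteq> 0\<^sub>v n \<and> M *\<^sub>v v = \<mu> \<cdot>\<^sub>v (N *\<^sub>v v) \<and>
    (\<forall>u\<in>carrier_vec n. \<mu> * (u \<bullet> (N *\<^sub>v u)) \<le> u \<bullet> (M *\<^sub>v u))"
proof -
  have Nc: "N \<in> carrier_mat n n" "N\<^sup>T = N" using N by (auto simp: sym_pd_def)
  have Npos: "0 < v \<bullet> (N *\<^sub>v v)" if "v \<in> carrier_vec n" "v \<noteq> 0\<^sub>v n" for v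
    using N that by (simp add: sym_pd_def)
  obtain C where C: "C > 0" "\<And>v. v \<in> carrier_vec n \<Longrightarrow> v \<bullet> v \<le> C * (v \<bullet> (N *\<^sub>v v))"
    using psd_nonsingular_coercive[OF sym_pd_imp_psd[OF N] sym_pd_det_nonzero[OF N]] by blast
  obtain D where D: "D > 0" "\<And>v. v \<in> carrier_vec n \<Longrightarrow> v \<bullet> (N *\<^sub>v v) \<le> D * (v \<bullet> v)"
    using form_bounded[OF Nc(1)] by blast
  \<comment> \<open>The upper bound for \<open>- M\<close> is a lower bound for the form of
    \<open>M\<close>; with coercivity of \<open>N\<close> it keeps the Rayleigh quotients bounded
    below, so that the infimum makes sense.\<close>
  obtain E where E: "E > 0" "\<And>v. v \<in> carrier_vec n \<Longrightarrow> v \<bullet> (- M *\<^sub>v v) \<le> E * (v \<bullet> v)"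
    using form_bounded[of "- M" n] M by auto
  define r where "r v = v \<bullet> (M *\<^sub>v v) / (v \<bullet> (N *\<^sub>v v))" for v
  define V :: "real vec set" where "V = {v \<in> carrier_vec n. v \<noteq> 0\<^sub>v n}"
  have "unit_vec n 0 $ 0 \<noteq> (0\<^sub>v n :: real vec) $ 0" using n by simp
  then have "unit_vec n 0 \<in> V" unfolding V_def by auto
  then have ne: "V \<noteq> {}" by blast
  have lb: "- (E * C) \<le> r v" if "v \<in> V" for v
  proof -
    have v: "v \<in> carrier_vec n" "v \<noteq> 0\<^sub>v n" using that by (auto simp: V_def)
    have "- (v \<bullet> (M *\<^sub>v v)) \<le> E * (v \<bullet> v)" using E(2)[OF v(1)] M v by simp
    also have "\<dots> \<le> E * (C * (v \<bullet> (N *\<^sub>v v)))" using C(2)[OF v(1)] E(1) by (intro mult_left_mono) auto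
    finally show ?thesis using Npos[OF v] unfolding r_def by (simp add: field_simps)
  qed
  then have bdd: "bdd_below (r ` V)" by (intro bdd_belowI2)
  define \<mu> where "\<mu> = Inf (r ` V)"
  have \<mu>: "\<mu> * (u \<bullet> (N *\<^sub>v u)) \<le> u \<bullet> (M *\<^sub>v u)" if u: "u \<in> carrier_vec n" for u
  proof (cases "u = 0\<^sub>v n")
    case True
    with M Nc show ?thesis by simp
  next
    case False
    have "\<mu> \<le> r u" unfolding \<mu>_def using u False by (intro cINF_lower bdd) (auto simp: V_def)
    with Npos[OF u False] show ?thesis by (simp add: r_def field_simps)
  qed
  define K where "K = M - \<mu> \<cdot>\<^sub>m N"
  have K: "K \<in> carrier_mat n n" using M Nc unfolding K_def by (intro minus_carrier_mat smult_carrier_mat)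
  have Kv: "K *\<^sub>v v = M *\<^sub>v v - \<mu> \<cdot>\<^sub>v (N *\<^sub>v v)" if "v \<in> carrier_vec n" for v
    using M Nc that by (simp add: K_def minus_mult_distrib_mat_vec[of _ n n] smult_mat_mult_vec[of _ n n])
  have Kf: "v \<bullet> (K *\<^sub>v v) = v \<bullet> (M *\<^sub>v v) - \<mu> * (v \<bullet> (N *\<^sub>v v))" if "v \<in> carrier_vec n" for v
    using M Nc that by (simp add: Kv scalar_prod_minus_distrib[of _ n] scalar_prod_smult_distrib[of _ n])
  have "K\<^sup>T = K"
    using M Nc transpose_mat_smult[of \<mu> N] unfolding K_def by (subst transpose_minus[of _ n n]) auto
  then have psd: "sym_psd n K" using K \<mu> by (auto simp: sym_psd_def Kf)
  have "det K = 0"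
  proof (rule ccontr)
    assume "det K \<noteq> 0"
    from psd_nonsingular_coercive[OF psd this]
    obtain F where F: "F > 0" "\<And>v. v \<in> carrier_vec n \<Longrightarrow> v \<bullet> v \<le> F * (v \<bullet> (K *\<^sub>v v))" by blast
    \<comment> \<open>The form of \<open>N\<close> at \<open>v\<close> is at most
      \<open>D * F\<close> times that of \<open>K\<close>, which is \<open>r v - \<mu>\<close> times
      the form of \<open>N\<close>; dividing gives the gap.\<close>
    have "\<mu> + 1 / (D * F) \<le> r v" if "v \<in> V" for v
    proof -
      have v: "v \<in> carrier_vec n" "v \<noteq> 0\<^sub>v n" using that by (auto simp: V_def)
      have "v \<bullet> (N *\<^sub>v v) \<le> D * (v \<bullet> v)" by (rule D(2)[OF v(1)])
      also have "\<dots> \<le> D * (F * (v \<bullet> (K *\<^sub>v v)))" using F(2)[OF v(1)] D(1) by (intro mult_left_mono) auto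
      finally show ?thesis using Npos[OF v] F(1) D(1) unfolding r_def Kf[OF v(1)]
        by (simp add: field_simps)
    qed
    then have "\<mu> + 1 / (D * F) \<le> \<mu>" unfolding \<mu>_def using ne by (intro cINF_greatest) auto
    then show False using D(1) F(1) by (simp add: field_simps)
  qed
  then obtain v where v: "v \<in> carrier_vec n" "v \<noteq> 0\<^sub>v n" "K *\<^sub>v v = 0\<^sub>v n"
    using det_0_iff_vec_prod_zero_field[OF K] by blast
  have "M *\<^sub>v v = \<mu> \<cdot>\<^sub>v (N *\<^sub>v v)"
  proof (rule eq_vecI)
    fix i assume "i < dim_vec (\<mu> \<cdot>\<^sub>v (N *\<^sub>v v))"
    then have i: "i < n" using Nc by simp
    have "(M *\<^sub>v v - \<mu> \<cdot>\<^sub>v (N *\<^sub>v v)) $ i = 0" using v Kv i by auto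
    then show "(M *\<^sub>v v) $ i = (\<mu> \<cdot>\<^sub>v (N *\<^sub>v v)) $ i" using i M Nc by simp
  qed (use M Nc in auto)
  with v \<mu> show ?thesis by blast
qed

lemma sym_pd_injective:
  assumes "sym_pd n N" "u \<in> carrier_vec n" "v \<in> carrier_vec n" "N *\<^sub>v u = N *\<^sub>v v"
  shows "u = v"
proof -
  have N: "N \<in> carrier_mat n n" using assms(1) by (simp add: sym_pd_def)
  obtain R where R: "R \<in> carrier_mat n n" "R * N = 1\<^sub>m n"
    using det_nonzero_inverse[OF N sym_pd_det_nonzero[OF assms(1)]] by metis
  have "R *\<^sub>v (N *\<^sub>v u) = R *\<^sub>v (N *\<^sub>v v)" using assms(4) by simp
  with R N assms(2,3) show ?thesis by (simp add: assoc_mult_mat_vec[symmetric])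
qed

text \<open>In applications \<open>K\<close> is an inverse of \<open>N\<close> times a symmetric
  matrix, hence not symmetric itself. Multiplying by \<open>N\<close> turns its eigenpairs into
  those of a symmetric pencil, with Rayleigh quotients taken in the inner product of
  \<open>N\<close>.\<close>

lemma pencil_eigenvector_iff:
  assumes "K \<in> carrier_mat n n" "sym_pd n N" "v \<in> carrier_vec n" "v \<noteq> 0\<^sub>v n"
  shows "eigenvector K v \<mu> \<longleftrightarrow> (N * K) *\<^sub>v v = \<mu> \<cdot>\<^sub>v (N *\<^sub>v v)"
proof -
  have N: "N \<in> carrier_mat n n" using assms(2) by (simp add: sym_pd_def)
  have "(N * K) *\<^sub>v v = N *\<^sub>v (K *\<^sub>v v)" "\<mu> \<cdot>\<^sub>v (N *\<^sub>v v) = N *\<^sub>v (\<mu> \<cdot>\<^sub>v v)"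
    using N assms by (simp_all add: mult_mat_vec[OF N])
  with assms sym_pd_injective[OF assms(2), of "K *\<^sub>v v" "\<mu> \<cdot>\<^sub>v v"] show ?thesis
    by (auto simp: eigenvector_def)
qed

lemma pencil_form_eigenvector:
  assumes "K \<in> carrier_mat n n" "sym_pd n N" "eigenvector K v \<mu>"
  shows "v \<bullet> ((N * K) *\<^sub>v v) = \<mu> * (v \<bullet> (N *\<^sub>v v))" "0 < v \<bullet> (N *\<^sub>v v)" "v \<in> carrier_vec n"
proof -
  show v: "v \<in> carrier_vec n" using assms by (auto simp: eigenvector_def)
  have N: "N \<in> carrier_mat n n" using assms(2) by (simp add: sym_pd_def)
  have "v \<noteq> 0\<^sub>v n" using assms by (auto simp: eigenvector_def)
  with v assms pencil_eigenvector_iff[OF assms(1,2)] N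
  show "v \<bullet> ((N * K) *\<^sub>v v) = \<mu> * (v \<bullet> (N *\<^sub>v v))" "0 < v \<bullet> (N *\<^sub>v v)"
    by (auto simp: scalar_prod_smult_distrib[of _ n] sym_pd_def)
qed

text \<open>An eigenvalue is the Rayleigh quotient at its eigenvector, so none lies below the pencil
  minimum, which is itself an eigenvalue. The attaining eigenvector is recorded because bounds on
  \<open>lambda_min\<close> are later obtained by evaluating forms at it.\<close>

lemma pencil_lambda_min:
  assumes n: "0 < n" and K: "K \<in> carrier_mat n n" and N: "sym_pd n N"
    and M: "(N * K)\<^sup>T = N * K"
  shows "u \<in> carrier_vec n \<Longrightarrow> lambda_min K * (u \<bullet> (N *\<^sub>v u)) \<le> u \<bullet> ((N * K) *\<^sub>v u)"
    and "\<exists>v. eigenvector K v (lambda_min K)"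
proof -
  have "N * K \<in> carrier_mat n n" using K N by (auto simp: sym_pd_def)
  then obtain \<mu> v where v: "v \<in> carrier_vec n" "v \<noteq> 0\<^sub>v n" "(N * K) *\<^sub>v v = \<mu> \<cdot>\<^sub>v (N *\<^sub>v v)"
    and le: "\<And>u. u \<in> carrier_vec n \<Longrightarrow> \<mu> * (u \<bullet> (N *\<^sub>v u)) \<le> u \<bullet> ((N * K) *\<^sub>v u)"
    using pencil_minimum[OF n _ M N] by blast
  have ev: "eigenvector K v \<mu>" using pencil_eigenvector_iff[OF K N] v by blast
  have "\<mu> \<le> \<nu>" if "eigenvector K w \<nu>" for w \<nu>
    using pencil_form_eigenvector[OF K N that] le[of w] by simp
  then have eq: "lambda_min K = \<mu>"
    unfolding lambda_min_def spectrum_def using ev card_finite_spectrum(1)[OF K]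
    by (intro Min_eqI) (auto simp: eigenvalue_def spectrum_def)
  show "\<exists>v. eigenvector K v (lambda_min K)" using ev eq by blast
  show "u \<in> carrier_vec n \<Longrightarrow> lambda_min K * (u \<bullet> (N *\<^sub>v u)) \<le> u \<bullet> ((N * K) *\<^sub>v u)"
    using le eq by blast
qed

lemma pencil_lambda_max:
  assumes n: "0 < n" and K: "K \<in> carrier_mat n n" and N: "sym_pd n N"
    and M: "(N * K)\<^sup>T = N * K"
  shows "u \<in> carrier_vec n \<Longrightarrow> u \<bullet> ((N * K) *\<^sub>v u) \<le> lambda_max K * (u \<bullet> (N *\<^sub>v u))"
    and "\<exists>v. eigenvector K v (lambda_max K)"
proof -
  have NK: "N * K \<in> carrier_mat n n" and Nc: "N \<in> carrier_mat n n"
    using K N by (auto simp: sym_pd_def)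
  \<comment> \<open>The maximum is the negated minimum of the pencil with
    \<open>- (N * K)\<close>.\<close>
  then have "- (N * K) \<in> carrier_mat n n" "(- (N * K))\<^sup>T = - (N * K)"
    using M by (auto simp: transpose_uminus)
  then obtain \<mu> v where v: "v \<in> carrier_vec n" "v \<noteq> 0\<^sub>v n"
      "(- (N * K)) *\<^sub>v v = \<mu> \<cdot>\<^sub>v (N *\<^sub>v v)"
    and le: "\<And>u. u \<in> carrier_vec n \<Longrightarrow> \<mu> * (u \<bullet> (N *\<^sub>v u)) \<le> u \<bullet> ((- (N * K)) *\<^sub>v u)"
    using pencil_minimum[OF n _ _ N] by blast
  have "(N * K) *\<^sub>v v = - (\<mu> \<cdot>\<^sub>v (N *\<^sub>v v))"
    using v NK by (metis uminus_mult_mat_vec carrier_matD(2) carrier_vecD uminus_uminus_vec)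
  also have "\<dots> = (- \<mu>) \<cdot>\<^sub>v (N *\<^sub>v v)" by (rule eq_vecI) auto
  finally have ev: "eigenvector K v (- \<mu>)" using pencil_eigenvector_iff[OF K N] v by blast
  have le': "u \<bullet> ((N * K) *\<^sub>v u) \<le> - \<mu> * (u \<bullet> (N *\<^sub>v u))" if "u \<in> carrier_vec n" for u
    using le[OF that] K Nc that by simp
  have "\<nu> \<le> - \<mu>" if "eigenvector K w \<nu>" for w \<nu>
    using pencil_form_eigenvector[OF K N that] le'[of w] by (metis mult_le_cancel_right_pos)
  then have eq: "lambda_max K = - \<mu>"
    unfolding lambda_max_def spectrum_def using ev card_finite_spectrum(1)[OF K]
    by (intro Max_eqI) (auto simp: eigenvalue_def spectrum_def)
  show "\<exists>v. eigenvector K v (lambda_max K)" using ev eq by metis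
  show "u \<in> carrier_vec n \<Longrightarrow> u \<bullet> ((N * K) *\<^sub>v u) \<le> lambda_max K * (u \<bullet> (N *\<^sub>v u))"
    using le' eq by simp
qed

section \<open>The spectral norm\<close>

lemma mat_norm2_upper:
  assumes M: "M \<in> carrier_mat n n" and v: "v \<in> carrier_vec n"
  shows "vec_norm2 (M *\<^sub>v v) \<le> mat_norm2 M * vec_norm2 v"
proof (cases "v = 0\<^sub>v n")
  case True
  have "M *\<^sub>v 0\<^sub>v n = 0\<^sub>v n" using M by (intro eq_vecI) auto
  with True show ?thesis by (simp add: vec_norm2_def)
next
  case False
  have MM: "(M *\<^sub>v u) \<bullet> (M *\<^sub>v u) = u \<bullet> ((M\<^sup>T * M) *\<^sub>v u)" if "u \<in> carrier_vec n" for u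
    using transpose_vec_mult_scalar[of "M\<^sup>T" n n "M *\<^sub>v u" u] M that by (simp add: comm_scalar_prod[of _ n])
  obtain C where C: "\<And>u. u \<in> carrier_vec n \<Longrightarrow> u \<bullet> ((M\<^sup>T * M) *\<^sub>v u) \<le> C * (u \<bullet> u)"
    using form_bounded[of "M\<^sup>T * M" n] M by auto
  have "vec_norm2 (M *\<^sub>v u) \<le> sqrt C" if "u \<in> carrier_vec n" "vec_norm2 u = 1" for u
  proof -
    have "u \<bullet> u = 1" using that vec_norm2_square[of u] by simp
    then show ?thesis using C[OF that(1)] MM[OF that(1)] by (simp add: vec_norm2_def)
  qed
  \<comment> \<open>The supremum defining the norm dominates its elements only once the set is known
    to be bounded; the form of \<open>M\<^sup>T * M\<close> supplies the bound.\<close>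
  then have bdd: "bdd_above ((\<lambda>u. vec_norm2 (M *\<^sub>v u)) ` {u \<in> carrier_vec (dim_col M). vec_norm2 u = 1})"
    using M by (intro bdd_aboveI2[where M = "sqrt C"]) auto
  have scale: "vec_norm2 (a \<cdot>\<^sub>v u) = \<bar>a\<bar> * vec_norm2 u" for a and u :: "real vec"
    by (simp add: vec_norm2_def real_sqrt_mult mult.assoc[symmetric] flip: power2_eq_square)
  define a where "a = vec_norm2 v"
  have a: "a > 0" using scalar_prod_self_pos[OF v False] by (simp add: a_def vec_norm2_def)
  have "vec_norm2 (M *\<^sub>v ((1 / a) \<cdot>\<^sub>v v)) \<le> mat_norm2 M"
    unfolding mat_norm2_def using M v a by (intro cSUP_upper bdd) (auto simp: scale a_def)
  then show ?thesis using a M v by (simp add: mult_mat_vec[OF M] scale field_simps flip: a_def)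
qed

text \<open>In dimension 0 there is no unit vector and the supremum is over the empty set; a
  positive dimension provides \<open>unit_vec n 0\<close>.\<close>

lemma mat_norm2_nonneg:
  assumes "M \<in> carrier_mat n n" "0 < n"
  shows "0 \<le> mat_norm2 M"
proof -
  have "vec_norm2 (unit_vec n 0) = 1" using assms(2) by (simp add: vec_norm2_def)
  with mat_norm2_upper[OF assms(1), of "unit_vec n 0"] vec_norm2_nonneg[of "M *\<^sub>v unit_vec n 0"]
  show ?thesis by simp
qed

subsection \<open>Inverses, diagonal matrices and rank\<close>

lemma mat_inv_correct:
  assumes "M \<in> carrier_mat n n" "det M \<noteq> 0"
  shows "mat_inv M \<in> carrier_mat n n" "M * mat_inv M = 1\<^sub>m n" "mat_inv M * M = 1\<^sub>m n"
proof -
  obtain B where "mat_inverse M = Some B"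
    using mat_inverse(1)[OF assms(1), of "()"] det_non_zero_imp_unit[OF assms, of "()"] by fastforce
  with mat_inverse(2)[OF assms(1)]
  show "mat_inv M \<in> carrier_mat n n" "M * mat_inv M = 1\<^sub>m n" "mat_inv M * M = 1\<^sub>m n" by auto
qed

lemma mat_inv_eqI:
  fixes M :: "'a :: field mat"
  assumes "M \<in> carrier_mat n n" "B \<in> carrier_mat n n" "B * M = 1\<^sub>m n"
  shows "mat_inv M = B"
proof -
  have "det B * det M = 1" using assms by (metis det_mult det_one)
  then have det: "det M \<noteq> 0" by auto
  note inv = mat_inv_correct[OF assms(1) det]
  have "mat_inv M = (B * M) * mat_inv M" using assms inv by simp
  also have "\<dots> = B * (M * mat_inv M)" using assms inv by (intro assoc_mult_mat) auto
  finally show ?thesis using assms inv by simp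
qed

lemma mat_inv_mat_diag:
  fixes f :: "nat \<Rightarrow> 'a :: field"
  assumes "\<And>i. i < n \<Longrightarrow> f i \<noteq> 0"
  shows "mat_inv (mat_diag n f) = mat_diag n (\<lambda>i. 1 / f i)"
proof (rule mat_inv_eqI)
  show "mat_diag n (\<lambda>i. 1 / f i) * mat_diag n f = 1\<^sub>m n"
    unfolding mat_diag_diag using assms by (auto simp: mat_diag_def)
qed auto

lemma mat_diag_mult_vec:
  assumes "v \<in> carrier_vec n"
  shows "mat_diag n f *\<^sub>v v = vec n (\<lambda>i. f i * v $ i)"
proof (rule eq_vecI)
  fix i assume "i < dim_vec (vec n (\<lambda>i. f i * v $ i))"
  then have i: "i < n" by simp
  have "row (mat_diag n f) i \<bullet> v = (\<Sum>j = 0..<n. if j = i then f i * v $ i else 0)"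
    unfolding scalar_prod_def using assms i by (intro sum.cong) (auto simp: mat_diag_def)
  then show "(mat_diag n f *\<^sub>v v) $ i = vec n (\<lambda>i. f i * v $ i) $ i"
    using i by (simp add: mat_diag_def)
qed (simp add: mat_diag_def)

lemma mat_diag_form:
  fixes f :: "nat \<Rightarrow> 'a :: comm_ring_1"
  assumes "u \<in> carrier_vec n" "v \<in> carrier_vec n"
  shows "u \<bullet> (mat_diag n f *\<^sub>v v) = (\<Sum>i<n. f i * (u $ i * v $ i))"
  using assms by (simp add: mat_diag_mult_vec scalar_prod_def atLeast0LessThan mult_ac)

lemma transpose_mat_diag [simp]: "(mat_diag n f)\<^sup>T = mat_diag n f"
  by (rule eq_matI) (auto simp: mat_diag_def)

lemma diagonal_mat_eq_mat_diag:
  assumes "diagonal_mat M" "M \<in> carrier_mat n n"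
  shows "M = mat_diag n (\<lambda>i. M $$ (i, i))"
  using assms by (intro eq_matI) (auto simp: mat_diag_def diagonal_mat_def)

lemma form_unit_vec:
  assumes "M \<in> carrier_mat n n" "i < n"
  shows "unit_vec n i \<bullet> (M *\<^sub>v unit_vec n i) = (M $$ (i, i) :: real)"
  using assms by simp

lemma sym_pd_diagonal_pos:
  assumes "sym_pd n M" "i < n"
  shows "0 < M $$ (i, i)"
proof -
  have "unit_vec n i $ i \<noteq> (0\<^sub>v n :: real vec) $ i" using assms(2) by simp
  then have "unit_vec n i \<noteq> (0\<^sub>v n :: real vec)" by auto
  then show ?thesis
    using assms form_unit_vec[of M n i] unfolding sym_pd_def by (metis unit_vec_carrier)
qed

lemma sym_psd_diagonal_nonneg:
  assumes "sym_psd n M" "i < n"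
  shows "0 \<le> M $$ (i, i)"
  using assms form_unit_vec[of M n i] unfolding sym_psd_def by (metis unit_vec_carrier)

lemma sym_pd_psd_add:
  assumes "sym_psd n M" "sym_pd n N"
  shows "sym_pd n (M + N)"
  using assms unfolding sym_psd_def sym_pd_def
  by (auto simp: transpose_add[of _ n n] add_mult_distrib_mat_vec[of _ n n]
      scalar_prod_add_distrib[of _ n] intro!: add_nonneg_pos)

text \<open>A maximal independent set of columns has \<open>m\<close> elements and forms a
  nonsingular square matrix \<open>B\<close>. The entries of \<open>B\<^sup>T *\<^sub>v y\<close>
  are among those of \<open>A\<^sup>T *\<^sub>v y\<close>, so \<open>y\<close> lies in the kernel of
  a nonsingular matrix.\<close>

lemma full_row_rank_transpose_injective:
  fixes A :: "'a :: field mat"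
  assumes A: "A \<in> carrier_mat m n" and rank: "vec_space.rank m A = m"
    and y: "y \<in> carrier_vec m" "A\<^sup>T *\<^sub>v y = 0\<^sub>v n"
  shows "y = 0\<^sub>v m"
proof -
  interpret vec_space "TYPE('a)" m .
  let ?P = "\<lambda>T. T \<subseteq> set (cols A) \<and> lin_indpt T"
  obtain S where S: "maximal S ?P" "finite S"
    using maximal_exists_superset[of "set (cols A)" ?P "{}"] finite_lin_indpt2[of "{}"] by auto
  then have sub: "S \<subseteq> set (cols A)" "lin_indpt S" by (auto simp: maximal_def)
  have card: "card S = m" using rank_card_indpt[OF A S(1)] rank by simp
  obtain xs where xs: "set xs = S" "distinct xs" using finite_distinct_list[OF S(2)] by blast
  have len: "length xs = m" using xs card distinct_card by fastforce
  define B where "B = mat_of_cols m xs"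
  have B: "B \<in> carrier_mat m m" using len by (auto simp: B_def)
  have car: "set xs \<subseteq> carrier_vec m" using sub(1) xs(1) A cols_dim by blast
  have cols: "cols B = xs" using car by (simp add: B_def)
  have "rank B = m" using lin_indpt_full_rank[OF B] cols xs sub(2) by simp
  then have "det B\<^sup>T \<noteq> 0" using det_rank_iff[OF B] det_transpose[OF B] by simp
  moreover have "B\<^sup>T *\<^sub>v y = 0\<^sub>v m"
  proof (rule eq_vecI)
    fix i assume "i < dim_vec (0\<^sub>v m :: 'a vec)"
    then have i: "i < m" by simp
    have "xs ! i \<in> set (cols A)" using i len sub(1) xs(1) by auto
    then obtain j where j: "j < n" "xs ! i = col A j"
      using A by (auto simp: cols_def)
    have "col A j \<bullet> y = (A\<^sup>T *\<^sub>v y) $ j" using j A by simp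
    also have "\<dots> = 0" using y(2) j by simp
    finally have "xs ! i \<bullet> y = 0" using j by simp
    moreover have "col B i = xs ! i" using i len car by (simp add: B_def subset_iff)
    ultimately show "(B\<^sup>T *\<^sub>v y) $ i = 0\<^sub>v m $ i" using i B by simp
  qed (use B in simp)
  ultimately show ?thesis using det_0_iff_vec_prod_zero_field[of "B\<^sup>T" m] B y(1) by auto
qed

subsection \<open>The preconditioned saddle point matrix\<close>

lemma Re_mult_mat_vec:
  assumes "M \<in> carrier_mat nr nc" "u \<in> carrier_vec nc"
  shows "map_vec Re (map_mat complex_of_real M *\<^sub>v u) = M *\<^sub>v map_vec Re u"
    "map_vec Im (map_mat complex_of_real M *\<^sub>v u) = M *\<^sub>v map_vec Im u"
  using assms by (auto intro!: eq_vecI simp: scalar_prod_def)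

text \<open>All matrices are real, so a complex eigenpair is a coupled pair of real equations; with
  these, Hermitian forms become sums of two real quadratic forms.\<close>

lemma eigenvector_Re_Im:
  assumes K: "K \<in> carrier_mat n n" and ev: "eigenvector (map_mat complex_of_real K) u lam"
  defines "a \<equiv> map_vec Re u" and "b \<equiv> map_vec Im u"
  shows "K *\<^sub>v a = Re lam \<cdot>\<^sub>v a - Im lam \<cdot>\<^sub>v b" "K *\<^sub>v b = Re lam \<cdot>\<^sub>v b + Im lam \<cdot>\<^sub>v a"
proof -
  have u: "u \<in> carrier_vec n" "map_mat complex_of_real K *\<^sub>v u = lam \<cdot>\<^sub>v u"
    using ev K by (auto simp: eigenvector_def)
  have "K *\<^sub>v a = map_vec Re (lam \<cdot>\<^sub>v u)" "K *\<^sub>v b = map_vec Im (lam \<cdot>\<^sub>v u)"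
    unfolding a_def b_def by (simp_all add: Re_mult_mat_vec[OF K u(1), symmetric] u(2))
  then show "K *\<^sub>v a = Re lam \<cdot>\<^sub>v a - Im lam \<cdot>\<^sub>v b" "K *\<^sub>v b = Re lam \<cdot>\<^sub>v b + Im lam \<cdot>\<^sub>v a"
    unfolding a_def b_def by (auto intro!: eq_vecI)
qed

lemma block_form:
  fixes P :: "'a :: comm_ring_1 mat"
  assumes "P \<in> carrier_mat n n" "Q \<in> carrier_mat n m" "R \<in> carrier_mat m n" "T \<in> carrier_mat m m"
    and "u \<in> carrier_vec n" "x \<in> carrier_vec n" "v \<in> carrier_vec m" "y \<in> carrier_vec m"
  shows "(u @\<^sub>v v) \<bullet> (four_block_mat P Q R T *\<^sub>v (x @\<^sub>v y)) =
    u \<bullet> (P *\<^sub>v x) + u \<bullet> (Q *\<^sub>v y) + v \<bullet> (R *\<^sub>v x) + v \<bullet> (T *\<^sub>v y)"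
proof -
  have "P *\<^sub>v x \<in> carrier_vec n" "Q *\<^sub>v y \<in> carrier_vec n" "R *\<^sub>v x \<in> carrier_vec m"
    "T *\<^sub>v y \<in> carrier_vec m"
    using assms by auto
  with assms show ?thesis
    by (simp add: four_block_mat_mult_vec[of _ n n _ m _ m] scalar_prod_append[of _ n _ m]
        scalar_prod_add_distrib[of _ n] scalar_prod_add_distrib[of _ m])
qed

text \<open>The equations tested below are the real and imaginary parts of \<open>\<A> z = \<lambda> P z\<close> for the
  vector \<open>z = (w - k, y)\<close> with \<open>k = G\<^sup>-\<^sup>1 A\<^sup>T y\<close>, where \<open>\<lambda> = \<alpha> + i \<beta>\<close> and the indices
  1, 2 stand for real and imaginary part. The test vectors are \<open>(w, 0)\<close> and \<open>(k, -y)\<close>.\<close>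

lemma saddle_point_identities:
  fixes H G A D \<Theta> \<Sigma> :: "real mat" and \<alpha> \<beta> :: real
  assumes H: "H \<in> carrier_mat n n" "H\<^sup>T = H" and G: "G \<in> carrier_mat n n" "G\<^sup>T = G"
    and D: "D \<in> carrier_mat n n" "G * D = 1\<^sub>m n" and A: "A \<in> carrier_mat m n"
    and \<Theta>: "\<Theta> \<in> carrier_mat m m" "\<Theta>\<^sup>T = \<Theta>" and \<Sigma>: "\<Sigma> \<in> carrier_mat m m" "\<Sigma>\<^sup>T = \<Sigma>"
    and x: "x1 \<in> carrier_vec n" "x2 \<in> carrier_vec n" and y: "y1 \<in> carrier_vec m" "y2 \<in> carrier_vec m"
  defines "\<A> \<equiv> four_block_mat H A\<^sup>T A (- \<Theta>)"
    and "P \<equiv> four_block_mat G A\<^sup>T A (A * D * A\<^sup>T - \<Sigma>)"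
  assumes Re: "\<A> *\<^sub>v (x1 @\<^sub>v y1) = \<alpha> \<cdot>\<^sub>v (P *\<^sub>v (x1 @\<^sub>v y1)) - \<beta> \<cdot>\<^sub>v (P *\<^sub>v (x2 @\<^sub>v y2))"
    and Im: "\<A> *\<^sub>v (x2 @\<^sub>v y2) = \<alpha> \<cdot>\<^sub>v (P *\<^sub>v (x2 @\<^sub>v y2)) + \<beta> \<cdot>\<^sub>v (P *\<^sub>v (x1 @\<^sub>v y1))"
  defines "k1 \<equiv> D *\<^sub>v (A\<^sup>T *\<^sub>v y1)" and "k2 \<equiv> D *\<^sub>v (A\<^sup>T *\<^sub>v y2)"
  defines "w1 \<equiv> x1 + k1" and "w2 \<equiv> x2 + k2"
  defines "g \<equiv> w1 \<bullet> (G *\<^sub>v w1) + w2 \<bullet> (G *\<^sub>v w2)"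
    and "s \<equiv> y1 \<bullet> (\<Sigma> *\<^sub>v y1) + y2 \<bullet> (\<Sigma> *\<^sub>v y2)"
    and "c \<equiv> w1 \<bullet> (H *\<^sub>v k2) - w1 \<bullet> (G *\<^sub>v k2) - (w2 \<bullet> (H *\<^sub>v k1) - w2 \<bullet> (G *\<^sub>v k1))"
  shows "\<alpha> * (g + s) = w1 \<bullet> (H *\<^sub>v w1) + w2 \<bullet> (H *\<^sub>v w2)
      + (2 * (k1 \<bullet> (G *\<^sub>v k1)) - k1 \<bullet> (H *\<^sub>v k1) + y1 \<bullet> (\<Theta> *\<^sub>v y1))
      + (2 * (k2 \<bullet> (G *\<^sub>v k2)) - k2 \<bullet> (H *\<^sub>v k2) + y2 \<bullet> (\<Theta> *\<^sub>v y2))"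
    and "\<beta> * g = - c" and "\<beta> * s = - c"
proof -
  have k: "k1 \<in> carrier_vec n" "k2 \<in> carrier_vec n" using A D y by (auto simp: k1_def k2_def)
  have w: "w1 \<in> carrier_vec n" "w2 \<in> carrier_vec n" using x k by (auto simp: w1_def w2_def)
  have Pc: "P \<in> carrier_mat (n + m) (n + m)"
    using G \<Sigma> by (auto simp: P_def)
  have Gk: "G *\<^sub>v (D *\<^sub>v (A\<^sup>T *\<^sub>v y)) = A\<^sup>T *\<^sub>v y" if "y \<in> carrier_vec m" for y
  proof -
    have "A\<^sup>T *\<^sub>v y \<in> carrier_vec n" using that A by auto
    then show ?thesis using G(1) D by (metis assoc_mult_mat_vec one_mult_mat_vec)
  qed
  have split: "u \<bullet> (M *\<^sub>v x1) = u \<bullet> (M *\<^sub>v w1) - u \<bullet> (M *\<^sub>v k1)"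
    "u \<bullet> (M *\<^sub>v x2) = u \<bullet> (M *\<^sub>v w2) - u \<bullet> (M *\<^sub>v k2)"
    if "u \<in> carrier_vec n" "M \<in> carrier_mat n n" for u M
    using that x k
    by (simp_all add: w1_def w2_def mult_add_distrib_mat_vec[of _ n n] scalar_prod_add_distrib[of _ n])
  have PA: "(u @\<^sub>v v) \<bullet> (\<A> *\<^sub>v (x @\<^sub>v y)) = u \<bullet> (H *\<^sub>v x) + u \<bullet> (G *\<^sub>v (D *\<^sub>v (A\<^sup>T *\<^sub>v y)))
      + (D *\<^sub>v (A\<^sup>T *\<^sub>v v)) \<bullet> (G *\<^sub>v x) - v \<bullet> (\<Theta> *\<^sub>v y)"
    "(u @\<^sub>v v) \<bullet> (P *\<^sub>v (x @\<^sub>v y)) = u \<bullet> (G *\<^sub>v x) + u \<bullet> (G *\<^sub>v (D *\<^sub>v (A\<^sup>T *\<^sub>v y)))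
      + (D *\<^sub>v (A\<^sup>T *\<^sub>v v)) \<bullet> (G *\<^sub>v x)
      + (D *\<^sub>v (A\<^sup>T *\<^sub>v v)) \<bullet> (G *\<^sub>v (D *\<^sub>v (A\<^sup>T *\<^sub>v y))) - v \<bullet> (\<Sigma> *\<^sub>v y)"
    if c: "u \<in> carrier_vec n" "x \<in> carrier_vec n" "v \<in> carrier_vec m" "y \<in> carrier_vec m" for u x v y
  proof -
    define l where "l = D *\<^sub>v (A\<^sup>T *\<^sub>v v)"
    have l: "l \<in> carrier_vec n" using A D c by (auto simp: l_def)
    have Av: "A\<^sup>T *\<^sub>v v \<in> carrier_vec n" using A c by auto
    \<comment> \<open>Since \<open>A\<^sup>T *\<^sub>v v = G *\<^sub>v l\<close>, every occurrence
      of the off-diagonal blocks becomes a form of \<open>G\<close>; this makes them comparable with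
      the diagonal block.\<close>
    have vA: "v \<bullet> (A *\<^sub>v z) = l \<bullet> (G *\<^sub>v z)" if "z \<in> carrier_vec n" for z
      using transpose_vec_mult_scalar[OF A that c(3)] Gk[OF c(3)] symmetric_form_commute[OF G l that]
        comm_scalar_prod[OF Av that] by (simp add: l_def)
    have d: "D *\<^sub>v (A\<^sup>T *\<^sub>v y) \<in> carrier_vec n" using A D c by auto
    have "v \<bullet> ((- \<Theta>) *\<^sub>v y) = - (v \<bullet> (\<Theta> *\<^sub>v y))" using c \<Theta> by simp
    moreover have "v \<bullet> ((A * D * A\<^sup>T - \<Sigma>) *\<^sub>v y) = v \<bullet> (A *\<^sub>v (D *\<^sub>v (A\<^sup>T *\<^sub>v y))) - v \<bullet> (\<Sigma> *\<^sub>v y)"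
    proof -
      have "(A * D * A\<^sup>T - \<Sigma>) *\<^sub>v y = (A * D * A\<^sup>T) *\<^sub>v y - \<Sigma> *\<^sub>v y"
        using A D \<Sigma> c by (intro minus_mult_distrib_mat_vec) auto
      also have "(A * D * A\<^sup>T) *\<^sub>v y = (A * D) *\<^sub>v (A\<^sup>T *\<^sub>v y)"
        using A D c by (intro assoc_mult_mat_vec) auto
      also have "\<dots> = A *\<^sub>v (D *\<^sub>v (A\<^sup>T *\<^sub>v y))"
        using A D c by (intro assoc_mult_mat_vec) auto
      finally show ?thesis using A d \<Sigma> c by (simp add: scalar_prod_minus_distrib[of _ m])
    qed
    moreover have "\<A> = four_block_mat H A\<^sup>T A (- \<Theta>)" "P = four_block_mat G A\<^sup>T A (A * D * A\<^sup>T - \<Sigma>)"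
      by (simp_all add: \<A>_def P_def)
    moreover have "- \<Theta> \<in> carrier_mat m m" "A * D * A\<^sup>T - \<Sigma> \<in> carrier_mat m m" "A\<^sup>T \<in> carrier_mat n m"
      using \<Theta> \<Sigma> A by auto
    ultimately show
      "(u @\<^sub>v v) \<bullet> (\<A> *\<^sub>v (x @\<^sub>v y)) = u \<bullet> (H *\<^sub>v x) + u \<bullet> (G *\<^sub>v (D *\<^sub>v (A\<^sup>T *\<^sub>v y)))
        + (D *\<^sub>v (A\<^sup>T *\<^sub>v v)) \<bullet> (G *\<^sub>v x) - v \<bullet> (\<Theta> *\<^sub>v y)"
      "(u @\<^sub>v v) \<bullet> (P *\<^sub>v (x @\<^sub>v y)) = u \<bullet> (G *\<^sub>v x) + u \<bullet> (G *\<^sub>v (D *\<^sub>v (A\<^sup>T *\<^sub>v y)))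
        + (D *\<^sub>v (A\<^sup>T *\<^sub>v v)) \<bullet> (G *\<^sub>v x)
        + (D *\<^sub>v (A\<^sup>T *\<^sub>v v)) \<bullet> (G *\<^sub>v (D *\<^sub>v (A\<^sup>T *\<^sub>v y))) - v \<bullet> (\<Sigma> *\<^sub>v y)"
      using c H G A d
      by (simp_all add: block_form[of _ n _ m] vA Gk flip: l_def)
  qed
  have test: "z \<bullet> (\<A> *\<^sub>v (x1 @\<^sub>v y1)) = \<alpha> * (z \<bullet> (P *\<^sub>v (x1 @\<^sub>v y1))) - \<beta> * (z \<bullet> (P *\<^sub>v (x2 @\<^sub>v y2)))"
    "z \<bullet> (\<A> *\<^sub>v (x2 @\<^sub>v y2)) = \<alpha> * (z \<bullet> (P *\<^sub>v (x2 @\<^sub>v y2))) + \<beta> * (z \<bullet> (P *\<^sub>v (x1 @\<^sub>v y1)))"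
    if "z \<in> carrier_vec (n + m)" for z
  proof -
    have "P *\<^sub>v (x1 @\<^sub>v y1) \<in> carrier_vec (n + m)" "P *\<^sub>v (x2 @\<^sub>v y2) \<in> carrier_vec (n + m)"
      using Pc x y by auto
    then show
      "z \<bullet> (\<A> *\<^sub>v (x1 @\<^sub>v y1)) = \<alpha> * (z \<bullet> (P *\<^sub>v (x1 @\<^sub>v y1))) - \<beta> * (z \<bullet> (P *\<^sub>v (x2 @\<^sub>v y2)))"
      "z \<bullet> (\<A> *\<^sub>v (x2 @\<^sub>v y2)) = \<alpha> * (z \<bullet> (P *\<^sub>v (x2 @\<^sub>v y2))) + \<beta> * (z \<bullet> (P *\<^sub>v (x1 @\<^sub>v y1)))"
      using that unfolding Re Im
      by (simp_all add: scalar_prod_add_distrib[of _ "n + m"] scalar_prod_minus_distrib[of _ "n + m"]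
          scalar_prod_smult_distrib[of _ "n + m"])
  qed
  have zero: "D *\<^sub>v (A\<^sup>T *\<^sub>v 0\<^sub>v m) = 0\<^sub>v n"
  proof -
    have "A\<^sup>T *\<^sub>v 0\<^sub>v m = 0\<^sub>v n" "D *\<^sub>v 0\<^sub>v n = 0\<^sub>v n" using A D by (auto intro!: eq_vecI)
    then show ?thesis by simp
  qed
  have T1: "u \<bullet> (H *\<^sub>v w1) - u \<bullet> (H *\<^sub>v k1) + u \<bullet> (G *\<^sub>v k1) = \<alpha> * (u \<bullet> (G *\<^sub>v w1)) - \<beta> * (u \<bullet> (G *\<^sub>v w2))"
    and T2: "u \<bullet> (H *\<^sub>v w2) - u \<bullet> (H *\<^sub>v k2) + u \<bullet> (G *\<^sub>v k2) = \<alpha> * (u \<bullet> (G *\<^sub>v w2)) + \<beta> * (u \<bullet> (G *\<^sub>v w1))"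
    if u: "u \<in> carrier_vec n" for u
  proof -
    have "u @\<^sub>v 0\<^sub>v m \<in> carrier_vec (n + m)" using u by auto
    from test[OF this]
    show "u \<bullet> (H *\<^sub>v w1) - u \<bullet> (H *\<^sub>v k1) + u \<bullet> (G *\<^sub>v k1) = \<alpha> * (u \<bullet> (G *\<^sub>v w1)) - \<beta> * (u \<bullet> (G *\<^sub>v w2))"
      "u \<bullet> (H *\<^sub>v w2) - u \<bullet> (H *\<^sub>v k2) + u \<bullet> (G *\<^sub>v k2) = \<alpha> * (u \<bullet> (G *\<^sub>v w2)) + \<beta> * (u \<bullet> (G *\<^sub>v w1))"
      using u x y k w G H \<Theta> \<Sigma>
      by (simp_all add: PA zero split flip: k1_def k2_def)
  qed
  have T3: "l \<bullet> (G *\<^sub>v w1) - l \<bullet> (G *\<^sub>v k1) - v \<bullet> (\<Theta> *\<^sub>v y1)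
      = \<alpha> * (l \<bullet> (G *\<^sub>v w1) - v \<bullet> (\<Sigma> *\<^sub>v y1)) - \<beta> * (l \<bullet> (G *\<^sub>v w2) - v \<bullet> (\<Sigma> *\<^sub>v y2))"
    and T4: "l \<bullet> (G *\<^sub>v w2) - l \<bullet> (G *\<^sub>v k2) - v \<bullet> (\<Theta> *\<^sub>v y2)
      = \<alpha> * (l \<bullet> (G *\<^sub>v w2) - v \<bullet> (\<Sigma> *\<^sub>v y2)) + \<beta> * (l \<bullet> (G *\<^sub>v w1) - v \<bullet> (\<Sigma> *\<^sub>v y1))"
    if v: "v \<in> carrier_vec m" and l: "l = D *\<^sub>v (A\<^sup>T *\<^sub>v v)" for v l
  proof -
    have lc: "l \<in> carrier_vec n" using A D v l by auto
    have "0\<^sub>v n @\<^sub>v v \<in> carrier_vec (n + m)" using v by auto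
    from test[OF this]
    show "l \<bullet> (G *\<^sub>v w1) - l \<bullet> (G *\<^sub>v k1) - v \<bullet> (\<Theta> *\<^sub>v y1)
      = \<alpha> * (l \<bullet> (G *\<^sub>v w1) - v \<bullet> (\<Sigma> *\<^sub>v y1)) - \<beta> * (l \<bullet> (G *\<^sub>v w2) - v \<bullet> (\<Sigma> *\<^sub>v y2))"
      "l \<bullet> (G *\<^sub>v w2) - l \<bullet> (G *\<^sub>v k2) - v \<bullet> (\<Theta> *\<^sub>v y2)
      = \<alpha> * (l \<bullet> (G *\<^sub>v w2) - v \<bullet> (\<Sigma> *\<^sub>v y2)) + \<beta> * (l \<bullet> (G *\<^sub>v w1) - v \<bullet> (\<Sigma> *\<^sub>v y1))"
      using v lc x y k w G H
      by (simp_all add: PA split flip: k1_def k2_def l)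
  qed
  have k_eq: "k1 = D *\<^sub>v (A\<^sup>T *\<^sub>v y1)" "k2 = D *\<^sub>v (A\<^sup>T *\<^sub>v y2)" by (simp_all add: k1_def k2_def)
  \<comment> \<open>Orienting all mixed forms the same way leaves identities that are linear in the
    forms and in their products with \<open>\<alpha>\<close> and \<open>\<beta>\<close>. In the
    combination for \<open>s\<close>, the equation tested with \<open>(0, y)\<close> is subtracted
    from the one tested with \<open>(k, 0)\<close>, and the mixed forms of \<open>G\<close> on the
    right cancel.\<close>
  note sym = symmetric_form_commute[OF H w(2,1)] symmetric_form_commute[OF G w(2,1)]
    symmetric_form_commute[OF H k(2,1)] symmetric_form_commute[OF G k(2,1)]
    symmetric_form_commute[OF H k(1) w(1)] symmetric_form_commute[OF H k(1) w(2)]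
    symmetric_form_commute[OF H k(2) w(1)] symmetric_form_commute[OF H k(2) w(2)]
    symmetric_form_commute[OF G k(1) w(1)] symmetric_form_commute[OF G k(1) w(2)]
    symmetric_form_commute[OF G k(2) w(1)] symmetric_form_commute[OF G k(2) w(2)]
    symmetric_form_commute[OF \<Theta> y(2,1)] symmetric_form_commute[OF \<Sigma> y(2,1)]
  show "\<alpha> * (g + s) = w1 \<bullet> (H *\<^sub>v w1) + w2 \<bullet> (H *\<^sub>v w2)
      + (2 * (k1 \<bullet> (G *\<^sub>v k1)) - k1 \<bullet> (H *\<^sub>v k1) + y1 \<bullet> (\<Theta> *\<^sub>v y1))
      + (2 * (k2 \<bullet> (G *\<^sub>v k2)) - k2 \<bullet> (H *\<^sub>v k2) + y2 \<bullet> (\<Theta> *\<^sub>v y2))"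
    using T1[OF w(1)] T2[OF w(2)] T1[OF k(1)] T2[OF k(2)] T3[OF y(1) k_eq(1)] T4[OF y(2) k_eq(2)]
    unfolding g_def s_def sym right_diff_distrib distrib_left by linarith
  show "\<beta> * g = - c"
    using T2[OF w(1)] T1[OF w(2)] unfolding g_def c_def sym distrib_left by linarith
  show "\<beta> * s = - c"
    using T2[OF k(1)] T1[OF k(2)] T4[OF y(1) k_eq(1)] T3[OF y(2) k_eq(2)]
    unfolding s_def c_def sym right_diff_distrib distrib_left by linarith
qed

section \<open>Diagonal entries of the augmented quotient\<close>

lemma four_block_mat_diag:
  "four_block_mat (mat_diag n f) (0\<^sub>m n k) (0\<^sub>m k n) (mat_diag k h) =
    mat_diag (n + k) (\<lambda>i. if i < n then f i else h (i - n))"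
  by (rule eq_matI) (auto simp: mat_diag_def)

lemma submatrix_mat_diag:
  assumes "L \<subseteq> {..<m}"
  shows "submatrix (mat_diag m f) L L = mat_diag (card L) (\<lambda>i. f (pick L i))"
proof -
  have L: "{i. i < m \<and> i \<in> L} = L" using assms by auto
  show ?thesis
  proof (rule eq_matI)
    fix i j
    assume "i < dim_row (mat_diag (card L) (\<lambda>i. f (pick L i)))"
      and "j < dim_col (mat_diag (card L) (\<lambda>i. f (pick L i)))"
    then have ij: "i < card L" "j < card L" by (auto simp: mat_diag_def)
    then have "pick L i \<in> L" "pick L j \<in> L" by (simp_all add: pick_in_set_le)
    then have "pick L i < m" "pick L j < m" using assms by auto
    moreover have "pick L i = pick L j \<longleftrightarrow> i = j"
    proof (cases i j rule: linorder_cases)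
      case less
      then show ?thesis using pick_mono_le[OF ij(2) less] by simp
    next
      case greater
      then show ?thesis using pick_mono_le[OF ij(1) greater] by simp
    qed simp
    ultimately show "submatrix (mat_diag m f) L L $$ (i, j) =
        mat_diag (card L) (\<lambda>i. f (pick L i)) $$ (i, j)"
      using ij by (simp add: submatrix_def mat_diag_def L)
  qed (simp_all add: dim_submatrix mat_diag_def L)
qed

lemma diag_mat_mat_diag: "set (diag_mat (mat_diag n f)) = f ` {..<n}"
  by (auto simp: diag_mat_def mat_diag_def)

text \<open>Here \<open>aug a p\<close> is the augmented matrix of \<open>G\<close> and
  \<open>aug b q\<close> that of \<open>J\<close>. The first block enters inverted and the second
  does not, so the quotients are \<open>b i / a i\<close> in one and the opposite way round,
  \<open>p i / q i\<close>, in the other. A set of values suffices because only its minimum and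
  maximum matter.\<close>

lemma augmented_diagonal_quotient:
  fixes a b p q :: "nat \<Rightarrow> real"
  assumes L: "L \<subseteq> {..<m}" and a: "\<And>i. i < n \<Longrightarrow> a i > 0" and b: "\<And>i. i < n \<Longrightarrow> b i > 0"
    and p: "\<And>i. i \<in> L \<Longrightarrow> p i > 0" and q: "\<And>i. i \<in> L \<Longrightarrow> q i > 0"
  defines "aug \<equiv> \<lambda>f h. mat_inv (four_block_mat (mat_inv (mat_diag n f)) (0\<^sub>m n (card L))
    (0\<^sub>m (card L) n) (submatrix (mat_diag m h) L L))"
  shows "set (diag_mat (aug b q * mat_inv (aug a p))) = (\<lambda>i. b i / a i) ` {..<n} \<union> (\<lambda>i. p i / q i) ` L"
proof -
  let ?d = "\<lambda>f h i. if i < n then 1 / f i else h (pick L (i - n))"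
  have pick: "pick L (i - n) \<in> L" if "i < n + card L" "\<not> i < n" for i
    using that pick_in_set_le[of "i - n" L] by simp
  have d0: "?d f h i \<noteq> (0 :: real)" if "\<And>i. i < n \<Longrightarrow> f i > 0" "\<And>i. i \<in> L \<Longrightarrow> h i > 0" "i < n + card L" for f h i
    using that pick[of i] by (auto simp: less_le)
  have aug: "aug f h = mat_diag (n + card L) (\<lambda>i. 1 / ?d f h i)"
    if f: "\<And>i. i < n \<Longrightarrow> f i > 0" and h: "\<And>i. i \<in> L \<Longrightarrow> h i > 0" for f h
  proof -
    have "mat_inv (mat_diag n f) = mat_diag n (\<lambda>i. 1 / f i)"
      using f by (intro mat_inv_mat_diag) (auto simp: less_le)
    then have "aug f h = mat_inv (mat_diag (n + card L) (?d f h))"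
      unfolding aug_def by (simp add: submatrix_mat_diag[OF L] four_block_mat_diag)
    also have "\<dots> = mat_diag (n + card L) (\<lambda>i. 1 / ?d f h i)"
      by (intro mat_inv_mat_diag d0) (use f h in simp_all)
    finally show ?thesis .
  qed
  have "mat_inv (mat_diag (n + card L) (\<lambda>i. 1 / ?d a p i)) = mat_diag (n + card L) (\<lambda>i. 1 / (1 / ?d a p i))"
  proof (rule mat_inv_mat_diag)
    fix i assume "i < n + card L"
    then have "?d a p i \<noteq> 0" using a p by (intro d0) simp_all
    then show "1 / ?d a p i \<noteq> 0" by simp
  qed
  then have "mat_inv (aug a p) = mat_diag (n + card L) (?d a p)"
    using a p by (subst aug) simp_all
  then have prod: "aug b q * mat_inv (aug a p) = mat_diag (n + card L) (\<lambda>i. 1 / ?d b q i * ?d a p i)"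
    using aug[OF b q] by simp
  have "(\<lambda>i. 1 / ?d b q i * ?d a p i) ` {..<n + card L} =
      (\<lambda>i. b i / a i) ` {..<n} \<union> (\<lambda>j. p (pick L j) / q (pick L j)) ` {..<card L}"
  proof -
    have "{..<n + card L} = {..<n} \<union> (\<lambda>j. n + j) ` {..<card L}"
      using image_add_atLeastLessThan[of n 0 "card L"] by (auto simp: lessThan_atLeast0)
    then show ?thesis by (simp add: image_Un image_image)
  qed
  also have "(\<lambda>j. p (pick L j) / q (pick L j)) ` {..<card L} = (\<lambda>i. p i / q i) ` pick L ` {..<card L}"
    by (simp add: image_image)
  also have "pick L ` {..<card L} = L"
  proof
    show "pick L ` {..<card L} \<subseteq> L" by (auto intro: pick_in_set_le)
    show "L \<subseteq> pick L ` {..<card L}"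
    \<comment> \<open>The position of \<open>i\<close> in the increasing enumeration of
      \<open>L\<close>, counted from 0, is the number of smaller elements of
      \<open>L\<close>.\<close>
    proof
      fix i assume i: "i \<in> L"
      have "finite L" using finite_subset[OF L] by simp
      then have "card {a \<in> L. a < i} < card L" using i by (intro psubset_card_mono) auto
      then show "i \<in> pick L ` {..<card L}" 
        by (intro image_eqI[of _ _ "card {a \<in> L. a < i}"]) (simp_all add: pick_card_in_set[OF i])
    qed
  qed
  finally show ?thesis unfolding prod diag_mat_mat_diag .
qed

lemma diagonal_quotient_form_bounds:
  fixes a b :: "nat \<Rightarrow> real"
  assumes "\<And>i. i \<in> I \<Longrightarrow> a i > 0" "\<And>i. i \<in> I \<Longrightarrow> b i > 0"
    and "\<And>i. i \<in> I \<Longrightarrow> lo \<le> b i / a i" "\<And>i. i \<in> I \<Longrightarrow> b i / a i \<le> up"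
  shows "lo * (\<Sum>i\<in>I. z i * z i / b i) \<le> (\<Sum>i\<in>I. z i * z i / a i)"
    and "(\<Sum>i\<in>I. z i * z i / a i) \<le> up * (\<Sum>i\<in>I. z i * z i / b i)"
proof -
  have eq: "z i * z i / a i = (b i / a i) * (z i * z i / b i)" if "i \<in> I" for i
    using assms(1,2)[OF that] by simp
  have nn: "0 \<le> z i * z i / b i" if "i \<in> I" for i using assms(2)[OF that] by simp
  show "lo * (\<Sum>i\<in>I. z i * z i / b i) \<le> (\<Sum>i\<in>I. z i * z i / a i)"
    unfolding sum_distrib_left
    by (rule sum_mono, subst eq, assumption, rule mult_right_mono[OF assms(3) nn])
  show "(\<Sum>i\<in>I. z i * z i / a i) \<le> up * (\<Sum>i\<in>I. z i * z i / b i)"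
    unfolding sum_distrib_left
    by (rule sum_mono, subst eq, assumption, rule mult_right_mono[OF assms(4) nn])
qed

text \<open>Multiplied out, the preconditioner has the same off-diagonal blocks as the saddle point
  matrix. The factored form gives nonsingularity: the outer factors are unit triangular, so the
  determinant is that of \<open>G\<close> times that of \<open>- \<Sigma>\<close>.\<close>

lemma indefinite_preconditioner:
  fixes G D A \<Sigma> :: "'a :: field mat"
  assumes G: "G \<in> carrier_mat n n" and D: "D \<in> carrier_mat n n" "G * D = 1\<^sub>m n" "D * G = 1\<^sub>m n"
    and A: "A \<in> carrier_mat m n" and \<Sigma>: "\<Sigma> \<in> carrier_mat m m" "det \<Sigma> \<noteq> 0"
  defines "P \<equiv> four_block_mat (1\<^sub>m n) (0\<^sub>m n m) (A * D) (1\<^sub>m m) *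
      four_block_mat G (0\<^sub>m n m) (0\<^sub>m m n) (- \<Sigma>) *
      four_block_mat (1\<^sub>m n) (D * A\<^sup>T) (0\<^sub>m m n) (1\<^sub>m m)"
  shows "P = four_block_mat G A\<^sup>T A (A * D * A\<^sup>T - \<Sigma>)" and "det P \<noteq> 0"
proof -
  define E where "E = A * D"
  define V where "V = D * A\<^sup>T"
  define W where "W = A * D * A\<^sup>T"
  define N where "N = - \<Sigma>"
  define L where "L = four_block_mat (1\<^sub>m n) (0\<^sub>m n m) E (1\<^sub>m m)"
  define M where "M = four_block_mat G (0\<^sub>m n m) (0\<^sub>m m n) N"
  define U where "U = four_block_mat (1\<^sub>m n) V (0\<^sub>m m n) (1\<^sub>m m)"
  have At: "A\<^sup>T \<in> carrier_mat n m" using A by simp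
  have E: "E \<in> carrier_mat m n" and V: "V \<in> carrier_mat n m" and W: "W \<in> carrier_mat m m"
    and N: "N \<in> carrier_mat m m"
    using A D \<Sigma> by (auto simp: E_def V_def W_def N_def)
  have EG: "E * G = A"
    using assoc_mult_mat[OF A D(1) G] D A by (simp add: E_def)
  have GV: "G * V = A\<^sup>T"
    using assoc_mult_mat[OF G D(1) At] D At by (simp add: V_def)
  have AV: "A * V = W"
    unfolding V_def W_def by (rule assoc_mult_mat[OF A D(1) At, symmetric])
  have LM: "L * M = four_block_mat G (0\<^sub>m n m) A N"
    unfolding L_def M_def using E G A N EG
    by (subst mult_four_block_mat[of _ n n _ m _ m]) auto
  have LMU: "four_block_mat G (0\<^sub>m n m) A N * U = four_block_mat G A\<^sup>T A (W + N)"
  proof -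
    have "four_block_mat G (0\<^sub>m n m) A N * U =
        four_block_mat (G * 1\<^sub>m n + 0\<^sub>m n m * 0\<^sub>m m n) (G * V + 0\<^sub>m n m * 1\<^sub>m m)
          (A * 1\<^sub>m n + N * 0\<^sub>m m n) (A * V + N * 1\<^sub>m m)"
      unfolding U_def using G A N V by (intro mult_four_block_mat) auto
    moreover have "G * 1\<^sub>m n + 0\<^sub>m n m * 0\<^sub>m m n = G" "A * 1\<^sub>m n + N * 0\<^sub>m m n = A" "N * 1\<^sub>m m = N"
      using G A N by auto
    moreover have "G * V + 0\<^sub>m n m * 1\<^sub>m m = A\<^sup>T" unfolding GV using At by simp
    ultimately show ?thesis by (simp only: AV)
  qed
  have P: "P = L * M * U" by (simp add: P_def L_def M_def U_def E_def V_def N_def)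
  have "W + N = W - \<Sigma>" using W \<Sigma> by (simp add: N_def minus_add_uminus_mat)
  with P LM LMU show "P = four_block_mat G A\<^sup>T A (A * D * A\<^sup>T - \<Sigma>)" by (simp add: W_def)
  have "det G * det D = 1" using D G by (metis det_mult det_one)
  then have "det G \<noteq> 0" by auto
  moreover have "det N \<noteq> 0"
  proof -
    have "N = (- 1) \<cdot>\<^sub>m \<Sigma>" unfolding N_def by (rule eq_matI) auto
    then show ?thesis using \<Sigma> by simp
  qed
  moreover have "det L = 1" "det U = 1" "det M = det G * det N"
    unfolding L_def U_def M_def using E V G N
    by (simp_all add: det_four_block_mat_upper_right_zero[of _ n _ m]
        det_four_block_mat_lower_left_zero[of _ n _ m])
  moreover have "L \<in> carrier_mat (n + m) (n + m)" "M \<in> carrier_mat (n + m) (n + m)"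
    "U \<in> carrier_mat (n + m) (n + m)"
    unfolding L_def U_def M_def using G N by auto
  then have "det P = det L * det M * det U"
    unfolding P by (simp add: det_mult[of _ "n + m"])
  ultimately show "det P \<noteq> 0" by simp
qed

section \<open>Schur complements and diagonal scaling\<close>

lemma transpose_congruence:
  fixes E :: "'a :: comm_semiring_0 mat"
  assumes "B \<in> carrier_mat m n" "E \<in> carrier_mat n n" "E\<^sup>T = E"
  shows "(B * E * B\<^sup>T)\<^sup>T = B * E * B\<^sup>T"
proof -
  have "B * E \<in> carrier_mat m n" "B\<^sup>T \<in> carrier_mat n m" using assms by auto
  then have "(B * E * B\<^sup>T)\<^sup>T = B\<^sup>T\<^sup>T * (B * E)\<^sup>T" by (rule transpose_mult)
  also have "\<dots> = B * (E * B\<^sup>T)" using transpose_mult[OF assms(1,2)] assms(3) by simp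
  also have "\<dots> = B * E * B\<^sup>T" using assms by (intro assoc_mult_mat[symmetric]) auto
  finally show ?thesis .
qed

lemma schur_complement_form:
  fixes f t :: "nat \<Rightarrow> real"
  assumes A: "A \<in> carrier_mat m n" and f: "\<And>i. i < n \<Longrightarrow> f i > 0"
  defines "M \<equiv> A * mat_inv (mat_diag n f) * A\<^sup>T + mat_diag m t"
  shows "M \<in> carrier_mat m m" "M\<^sup>T = M"
    and "y \<in> carrier_vec m \<Longrightarrow> y \<bullet> (M *\<^sub>v y) =
      (A\<^sup>T *\<^sub>v y) \<bullet> (mat_inv (mat_diag n f) *\<^sub>v (A\<^sup>T *\<^sub>v y)) + y \<bullet> (mat_diag m t *\<^sub>v y)"
    and "y \<in> carrier_vec m \<Longrightarrow> y \<bullet> (M *\<^sub>v y) =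
      (\<Sum>i<n. (A\<^sup>T *\<^sub>v y) $ i * (A\<^sup>T *\<^sub>v y) $ i / f i) + (\<Sum>i<m. t i * (y $ i * y $ i))"
proof -
  have D: "mat_inv (mat_diag n f) = mat_diag n (\<lambda>i. 1 / f i)"
    using f by (intro mat_inv_mat_diag) (auto simp: less_le)
  define E where "E = mat_diag n (\<lambda>i. 1 / f i)"
  have E: "E \<in> carrier_mat n n" "E\<^sup>T = E" by (simp_all add: E_def)
  define W where "W = A * E * A\<^sup>T"
  have M: "M = W + mat_diag m t" unfolding M_def D E_def[symmetric] W_def ..
  have AE: "A * E \<in> carrier_mat m n" and At: "A\<^sup>T \<in> carrier_mat n m" using A E by auto
  have W: "W \<in> carrier_mat m m" unfolding W_def using AE At by (rule mult_carrier_mat)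
  show "M \<in> carrier_mat m m" using W by (simp add: M)
  have "W\<^sup>T = W" unfolding W_def by (rule transpose_congruence[OF A E])
  then show "M\<^sup>T = M" using W by (simp add: M transpose_add[of _ m m])
  assume y: "y \<in> carrier_vec m"
  define z where "z = A\<^sup>T *\<^sub>v y"
  have z: "z \<in> carrier_vec n" unfolding z_def using At y by (rule mult_mat_vec_carrier)
  have Ez: "E *\<^sub>v z \<in> carrier_vec n" using E(1) z by (rule mult_mat_vec_carrier)
  have "W *\<^sub>v y = A *\<^sub>v (E *\<^sub>v z)"
    unfolding W_def z_def assoc_mult_mat_vec[OF AE At y]
    by (rule assoc_mult_mat_vec[OF A E(1) z[unfolded z_def]])
  then have "y \<bullet> (W *\<^sub>v y) = z \<bullet> (E *\<^sub>v z)"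
    using transpose_vec_mult_scalar[OF A Ez y] unfolding z_def by simp
  moreover have "M *\<^sub>v y = W *\<^sub>v y + mat_diag m t *\<^sub>v y"
    unfolding M using W y by (intro add_mult_distrib_mat_vec) auto
  moreover have "W *\<^sub>v y \<in> carrier_vec m" "mat_diag m t *\<^sub>v y \<in> carrier_vec m"
    by (rule mult_mat_vec_carrier[OF W y], rule mult_mat_vec_carrier[OF mat_diag_dim y])
  ultimately have form: "y \<bullet> (M *\<^sub>v y) = z \<bullet> (E *\<^sub>v z) + y \<bullet> (mat_diag m t *\<^sub>v y)"
    using scalar_prod_add_distrib[OF y, of "W *\<^sub>v y" "mat_diag m t *\<^sub>v y"] by simp
  then show "y \<bullet> (M *\<^sub>v y) =
      (A\<^sup>T *\<^sub>v y) \<bullet> (mat_inv (mat_diag n f) *\<^sub>v (A\<^sup>T *\<^sub>v y)) + y \<bullet> (mat_diag m t *\<^sub>v y)"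
    unfolding D E_def z_def .
  show "y \<bullet> (M *\<^sub>v y) =
      (\<Sum>i<n. (A\<^sup>T *\<^sub>v y) $ i * (A\<^sup>T *\<^sub>v y) $ i / f i) + (\<Sum>i<m. t i * (y $ i * y $ i))"
    unfolding form E_def mat_diag_form[OF z z] mat_diag_form[OF y y] by (simp add: z_def)
qed

text \<open>The diagonal \<open>t\<close> is only nonnegative, so strict positivity must come from
  the first summand: injectivity of \<open>A\<^sup>T\<close> gives a nonzero coordinate of
  \<open>A\<^sup>T *\<^sub>v y\<close>.\<close>

lemma schur_complement_pd:
  fixes f t :: "nat \<Rightarrow> real"
  assumes A: "A \<in> carrier_mat m n" and inj: "\<And>y. y \<in> carrier_vec m \<Longrightarrow> A\<^sup>T *\<^sub>v y = 0\<^sub>v n \<Longrightarrow> y = 0\<^sub>v m"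
    and f: "\<And>i. i < n \<Longrightarrow> f i > 0" and t: "\<And>i. i < m \<Longrightarrow> t i \<ge> 0"
  shows "sym_pd m (A * mat_inv (mat_diag n f) * A\<^sup>T + mat_diag m t)"
  unfolding sym_pd_def
proof (intro conjI ballI impI)
  fix y :: "real vec" assume y: "y \<in> carrier_vec m" "y \<noteq> 0\<^sub>v m"
  have z: "A\<^sup>T *\<^sub>v y \<in> carrier_vec n" using A y by auto
  then obtain i where i: "i < n" "(A\<^sup>T *\<^sub>v y) $ i \<noteq> 0"
    using inj[OF y(1)] y(2) by (metis carrier_vecD eq_vecI index_zero_vec)
  have "0 < (\<Sum>i<n. (A\<^sup>T *\<^sub>v y) $ i * (A\<^sup>T *\<^sub>v y) $ i / f i)"
    using i f by (intro sum_pos2[of _ i]) (auto simp: less_imp_le zero_less_mult_iff intro!: divide_pos_pos)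
  moreover have "0 \<le> (\<Sum>i<m. t i * (y $ i * y $ i))" using t by (intro sum_nonneg) auto
  ultimately show "0 < y \<bullet> ((A * mat_inv (mat_diag n f) * A\<^sup>T + mat_diag m t) *\<^sub>v y)"
    using schur_complement_form(4)[OF A, of f y t] f y(1) by simp
qed (use schur_complement_form(1,2)[OF A] f in auto)

text \<open>Both forms are weighted sums of the same squares, indexed by \<open>n\<close>
  coordinates of \<open>A\<^sup>T *\<^sub>v y\<close> and the coordinates of \<open>y\<close> in
  \<open>L\<close>. Bounds on the quotients of weights carry over term by term.\<close>

lemma schur_complement_compare:
  fixes a b p q :: "nat \<Rightarrow> real"
  assumes A: "A \<in> carrier_mat m n" and y: "y \<in> carrier_vec m"
    and a: "\<And>i. i < n \<Longrightarrow> a i > 0" and b: "\<And>i. i < n \<Longrightarrow> b i > 0" and L: "L \<subseteq> {..<m}"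
    and p: "\<And>i. i \<in> L \<Longrightarrow> p i > 0" and q: "\<And>i. i \<in> L \<Longrightarrow> q i > 0"
    and p0: "\<And>i. i < m \<Longrightarrow> i \<notin> L \<Longrightarrow> p i = 0" and q0: "\<And>i. i < m \<Longrightarrow> i \<notin> L \<Longrightarrow> q i = 0"
    and lo: "\<And>i. i < n \<Longrightarrow> lo \<le> b i / a i" "\<And>i. i \<in> L \<Longrightarrow> lo \<le> p i / q i"
    and up: "\<And>i. i < n \<Longrightarrow> b i / a i \<le> up" "\<And>i. i \<in> L \<Longrightarrow> p i / q i \<le> up"
  defines "S \<equiv> A * mat_inv (mat_diag n a) * A\<^sup>T + mat_diag m p"
    and "T \<equiv> A * mat_inv (mat_diag n b) * A\<^sup>T + mat_diag m q"
  shows "lo * (y \<bullet> (T *\<^sub>v y)) \<le> y \<bullet> (S *\<^sub>v y)" "y \<bullet> (S *\<^sub>v y) \<le> up * (y \<bullet> (T *\<^sub>v y))"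
proof -
  \<comment> \<open>Weights written as reciprocals let the second group use the same comparison as
    the first, as \<open>(1 / q i) / (1 / p i) = p i / q i\<close>.\<close>
  have restrict: "(\<Sum>i<m. t i * (y $ i * y $ i)) = (\<Sum>i\<in>L. y $ i * y $ i / (1 / t i))"
    if "\<And>i. i < m \<Longrightarrow> i \<notin> L \<Longrightarrow> t i = 0" for t :: "nat \<Rightarrow> real"
    using that L by (intro sum.mono_neutral_cong_right) auto
  have rp: "(\<Sum>i<m. p i * (y $ i * y $ i)) = (\<Sum>i\<in>L. y $ i * y $ i / (1 / p i))"
    using p0 by (rule restrict)
  have rq: "(\<Sum>i<m. q i * (y $ i * y $ i)) = (\<Sum>i\<in>L. y $ i * y $ i / (1 / q i))"
    using q0 by (rule restrict)
  have p': "1 / p i > 0" and q': "1 / q i > 0" if "i \<in> L" for i using p[OF that] q[OF that] by simp_all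
  have S: "y \<bullet> (S *\<^sub>v y) =
      (\<Sum>i<n. (A\<^sup>T *\<^sub>v y) $ i * (A\<^sup>T *\<^sub>v y) $ i / a i) + (\<Sum>i<m. p i * (y $ i * y $ i))"
    and T: "y \<bullet> (T *\<^sub>v y) =
      (\<Sum>i<n. (A\<^sup>T *\<^sub>v y) $ i * (A\<^sup>T *\<^sub>v y) $ i / b i) + (\<Sum>i<m. q i * (y $ i * y $ i))"
    unfolding S_def T_def using a b y by (simp_all add: schur_complement_form(4)[OF A])
  have 1: "lo * (\<Sum>i<n. (A\<^sup>T *\<^sub>v y) $ i * (A\<^sup>T *\<^sub>v y) $ i / b i)
      \<le> (\<Sum>i<n. (A\<^sup>T *\<^sub>v y) $ i * (A\<^sup>T *\<^sub>v y) $ i / a i)"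
    "(\<Sum>i<n. (A\<^sup>T *\<^sub>v y) $ i * (A\<^sup>T *\<^sub>v y) $ i / a i)
      \<le> up * (\<Sum>i<n. (A\<^sup>T *\<^sub>v y) $ i * (A\<^sup>T *\<^sub>v y) $ i / b i)"
    using diagonal_quotient_form_bounds[of "{..<n}" a b lo up "\<lambda>i. (A\<^sup>T *\<^sub>v y) $ i"] a b lo(1) up(1)
    by auto
  have 2: "lo * (\<Sum>i\<in>L. y $ i * y $ i / (1 / q i)) \<le> (\<Sum>i\<in>L. y $ i * y $ i / (1 / p i))"
    "(\<Sum>i\<in>L. y $ i * y $ i / (1 / p i)) \<le> up * (\<Sum>i\<in>L. y $ i * y $ i / (1 / q i))"
    using diagonal_quotient_form_bounds[of L "\<lambda>i. 1 / p i" "\<lambda>i. 1 / q i" lo up "\<lambda>i. y $ i"] p' q' lo(2) up(2)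
    by simp_all
  show "lo * (y \<bullet> (T *\<^sub>v y)) \<le> y \<bullet> (S *\<^sub>v y)"
    unfolding S T rp rq distrib_left using 1(1) 2(1) by linarith
  show "y \<bullet> (S *\<^sub>v y) \<le> up * (y \<bullet> (T *\<^sub>v y))"
    unfolding S T rp rq distrib_left using 1(2) 2(2) by linarith
qed

text \<open>\<open>F\<close> and \<open>R\<close> are the square root of \<open>G\<close> and its
  inverse. The substitution of \<open>F *\<^sub>v u\<close> for \<open>u\<close> turns the forms of
  \<open>H\<close> and \<open>G\<close> into those of \<open>X\<close> and the identity, so
  eigenvalues and norms of matrices in \<open>X\<close> become bounds relative to
  \<open>G\<close>.\<close>

lemma diagonal_scaling:
  fixes g :: "nat \<Rightarrow> real" and H :: "real mat"
  assumes H: "H \<in> carrier_mat n n" "H\<^sup>T = H" and g: "\<And>i. i < n \<Longrightarrow> g i > 0"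
  defines "F \<equiv> mat_diag n (\<lambda>i. sqrt (g i))" and "R \<equiv> diag_inv_sqrt (mat_diag n g)"
  shows "R * H * R \<in> carrier_mat n n" "(R * H * R)\<^sup>T = R * H * R"
    and "u \<in> carrier_vec n \<Longrightarrow> v \<in> carrier_vec n \<Longrightarrow> u \<bullet> (H *\<^sub>v v) = (F *\<^sub>v u) \<bullet> ((R * H * R) *\<^sub>v (F *\<^sub>v v))"
    and "u \<in> carrier_vec n \<Longrightarrow> v \<in> carrier_vec n \<Longrightarrow> u \<bullet> (mat_diag n g *\<^sub>v v) = (F *\<^sub>v u) \<bullet> (F *\<^sub>v v)"
proof -
  have R: "R = mat_diag n (\<lambda>i. 1 / sqrt (g i))"
    unfolding R_def diag_inv_sqrt_def by (rule eq_matI) (auto simp: mat_diag_def)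
  have c: "R \<in> carrier_mat n n" "F \<in> carrier_mat n n" "R\<^sup>T = R" "F\<^sup>T = F" by (simp_all add: R F_def)
  have RF: "R *\<^sub>v (F *\<^sub>v v) = v" "F *\<^sub>v (R *\<^sub>v v) = v" if "v \<in> carrier_vec n" for v
  proof -
    have "sqrt (g i) \<noteq> 0" if "i < n" for i using g[OF that] by simp
    then show "R *\<^sub>v (F *\<^sub>v v) = v" "F *\<^sub>v (R *\<^sub>v v) = v"
      using that by (auto simp: R F_def mat_diag_mult_vec intro!: eq_vecI)
  qed
  have Fsym: "(F *\<^sub>v u) \<bullet> v = u \<bullet> (F *\<^sub>v v)" if "u \<in> carrier_vec n" "v \<in> carrier_vec n" for u v
    using transpose_vec_mult_scalar[OF c(2) that(2,1)] c(4) by simp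
  show "R * H * R \<in> carrier_mat n n" using c H by auto
  show "(R * H * R)\<^sup>T = R * H * R"
    using transpose_congruence[OF c(1) H] c(3) by simp
  assume uv: "u \<in> carrier_vec n" "v \<in> carrier_vec n"
  have Fv: "F *\<^sub>v v \<in> carrier_vec n" using c uv by auto
  have "(R * H * R) *\<^sub>v (F *\<^sub>v v) = (R * H) *\<^sub>v (R *\<^sub>v (F *\<^sub>v v))"
    using c H Fv by (intro assoc_mult_mat_vec) auto
  also have "\<dots> = R *\<^sub>v (H *\<^sub>v v)"
    using c H uv RF(1)[OF uv(2)] by simp
  finally show "u \<bullet> (H *\<^sub>v v) = (F *\<^sub>v u) \<bullet> ((R * H * R) *\<^sub>v (F *\<^sub>v v))"
    using H c uv by (simp add: Fsym RF)
  have "F *\<^sub>v (F *\<^sub>v v) = mat_diag n g *\<^sub>v v"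
    using uv less_imp_le[OF g]
    by (auto simp: F_def mat_diag_mult_vec mult.assoc[symmetric] intro!: eq_vecI)
  then show "u \<bullet> (mat_diag n g *\<^sub>v v) = (F *\<^sub>v u) \<bullet> (F *\<^sub>v v)"
    using Fsym[OF uv(1) Fv] by simp
qed

lemma sym_pd_mat_diag:
  fixes f :: "nat \<Rightarrow> real"
  assumes "\<And>i. i < n \<Longrightarrow> f i > 0"
  shows "sym_pd n (mat_diag n f)"
  unfolding sym_pd_def
proof (intro conjI ballI impI)
  fix v :: "real vec" assume v: "v \<in> carrier_vec n" "v \<noteq> 0\<^sub>v n"
  then obtain i where "i < n" "v $ i \<noteq> 0" by (metis carrier_vecD eq_vecI index_zero_vec)
  then have "0 < (\<Sum>i<n. f i * (v $ i * v $ i))"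
    using assms by (intro sum_pos2[of _ i]) (auto simp: less_imp_le zero_less_mult_iff)
  then show "0 < v \<bullet> (mat_diag n f *\<^sub>v v)" by (simp add: mat_diag_form[OF v(1) v(1)])
qed auto

text \<open>If \<open>\<beta>\<close> is nonzero, the two equations for it force
  \<open>g = s\<close>, so both quotients get weight one half. Adding these equations gives
  \<open>\<bar>\<beta>\<bar> * (g + s) = 2 * \<bar>c\<bar>\<close>, which explains the factor 2 in
  the assumption on \<open>c\<close>.\<close>

lemma two_component_bounds:
  fixes \<alpha> \<beta> g s h t c K l1 l2 u1 u2 :: real
  assumes "0 \<le> g" "0 \<le> s" "0 < g + s" and re: "\<alpha> * (g + s) = h + t"
    and im: "\<beta> * g = - c" "\<beta> * s = - c"
    and h: "l1 * g \<le> h" "h \<le> u1 * g" and t: "l2 * s \<le> t" "t \<le> u2 * s"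
    and c: "2 * \<bar>c\<bar> \<le> K * (g + s)"
  shows "\<beta> \<noteq> 0 \<Longrightarrow> (l1 + l2) / 2 \<le> \<alpha> \<and> \<alpha> \<le> (u1 + u2) / 2"
    and "min l1 l2 \<le> \<alpha>" "\<alpha> \<le> max u1 u2"
    and "s = 0 \<Longrightarrow> l1 \<le> \<alpha> \<and> \<alpha> \<le> u1"
    and "\<bar>\<beta>\<bar> \<le> K"
proof -
  have 1: "(l1 + l2) / 2 \<le> \<alpha> \<and> \<alpha> \<le> (u1 + u2) / 2" if "g = s"
  proof -
    have "(l1 + l2) * s \<le> (2 * \<alpha>) * s" "(2 * \<alpha>) * s \<le> (u1 + u2) * s"
      using re h t that by (simp_all add: algebra_simps)
    then show ?thesis using that assms(3) by simp
  qed
  show "(l1 + l2) / 2 \<le> \<alpha> \<and> \<alpha> \<le> (u1 + u2) / 2" if "\<beta> \<noteq> 0"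
    using im that by (intro 1) (metis mult_left_cancel)
  have "min l1 l2 * g \<le> l1 * g" "min l1 l2 * s \<le> l2 * s" "u1 * g \<le> max u1 u2 * g" "u2 * s \<le> max u1 u2 * s"
    using assms(1,2) by (auto intro: mult_right_mono)
  then have "min l1 l2 * (g + s) \<le> \<alpha> * (g + s)" "\<alpha> * (g + s) \<le> max u1 u2 * (g + s)"
    unfolding re using h t by (simp_all only: distrib_left)
  then show "min l1 l2 \<le> \<alpha>" "\<alpha> \<le> max u1 u2" using assms(3) by simp_all
  \<comment> \<open>With \<open>s = 0\<close> the bounds on \<open>t\<close> collapse to
    \<open>t = 0\<close>, leaving the single quotient \<open>h / g\<close>.\<close>
  show "l1 \<le> \<alpha> \<and> \<alpha> \<le> u1" if "s = 0"
    using that re h t assms(3) by (metis add.right_neutral mult_le_cancel_right_pos mult_zero_right order_antisym)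
  have "\<bar>\<beta>\<bar> * (g + s) = \<bar>\<beta> * (g + s)\<bar>" using assms(3) by (simp add: abs_mult)
  also have "\<dots> = 2 * \<bar>c\<bar>" using im by (simp add: distrib_left)
  finally show "\<bar>\<beta>\<bar> \<le> K" using c assms(3) by (metis mult_le_cancel_right_pos)
qed

section \<open>Eigenvalue bounds for the preconditioned matrix\<close>

theorem corollary3p3:
  fixes n m m1 :: nat
    and Q A \<Theta>1 \<Theta>2 G S J \<Theta>2upd Supd \<A> Pupd Gt Jt X :: "real mat"
    and L :: "nat set"
    and \<gamma>_first \<gamma>_last lam_up lam_lo :: real
    and lam :: complex and x y :: "complex vec"
  assumes "m \<le> n"
    and "sym_psd n Q"
    and "A \<in> carrier_mat m n" and "vec_space.rank m A = min m n"
    and "diagonal_mat \<Theta>1" and "sym_pd n \<Theta>1"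
    and "diagonal_mat \<Theta>2" and "sym_psd m \<Theta>2" and "\<Theta>2 \<noteq> 0\<^sub>m m m"
    and "L = {i. i < m \<and> \<Theta>2 $$ (i, i) \<noteq> 0}" and "m1 = card L"
    and "G = diag_part (Q + \<Theta>1)"
    and "S = A * mat_inv G * transpose_mat A + \<Theta>2"
    and "diagonal_mat J" and "sym_pd n J"
    and "diagonal_mat \<Theta>2upd" and "sym_psd m \<Theta>2upd"
    and "{i. i < m \<and> \<Theta>2upd $$ (i, i) \<noteq> 0} = L"
    and "Supd = A * mat_inv J * transpose_mat A + \<Theta>2upd"
    and "\<A> = four_block_mat (Q + \<Theta>1) (transpose_mat A) A (- \<Theta>2)"
    and "Pupd =
      four_block_mat (1\<^sub>m n) (0\<^sub>m n m) (A * mat_inv G) (1\<^sub>m m) *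
      four_block_mat G (0\<^sub>m n m) (0\<^sub>m m n) (- Supd) *
      four_block_mat (1\<^sub>m n) (mat_inv G * transpose_mat A) (0\<^sub>m m n) (1\<^sub>m m)"
    and "Gt = mat_inv
      (four_block_mat (mat_inv G) (0\<^sub>m n m1) (0\<^sub>m m1 n) (submatrix \<Theta>2 L L))"
    and "Jt = mat_inv
      (four_block_mat (mat_inv J) (0\<^sub>m n m1) (0\<^sub>m m1 n) (submatrix \<Theta>2upd L L))"
    and "\<gamma>_first = min_diag (Jt * mat_inv Gt)"
    and "\<gamma>_last = max_diag (Jt * mat_inv Gt)"
    and "X = diag_inv_sqrt G * (Q + \<Theta>1) * diag_inv_sqrt G"
    and "sym_pd n (2 \<cdot>\<^sub>m 1\<^sub>m n - X)"
    and "lam_up = lambda_max (mat_inv Supd * S) * max (2 - lambda_min X) 1"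
    and "lam_lo = lambda_min (mat_inv Supd * S) * min (2 - lambda_max X) 1"
    and "x \<in> carrier_vec n" and "y \<in> carrier_vec m"
    and "eigenvector (map_mat complex_of_real (mat_inv Pupd * \<A>)) (x @\<^sub>v y) lam"
  shows "(Im lam \<noteq> 0 \<longrightarrow>
            (lambda_min X + lam_lo) / 2 \<le> Re lam \<and> Re lam \<le> (lambda_max X + lam_up) / 2)
    \<and> (Im lam = 0 \<longrightarrow>
         (y \<noteq> 0\<^sub>v m \<longrightarrow>
            min (lambda_min X) lam_lo \<le> Re lam \<and> Re lam \<le> max (lambda_max X) lam_up) \<and>
         (y = 0\<^sub>v m \<longrightarrow>
            lambda_min X \<le> Re lam \<and> Re lam \<le> lambda_max X))
    \<and> lam_up \<le> \<gamma>_last * max (2 - lambda_min X) 1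
    \<and> lam_lo \<ge> \<gamma>_first * min (2 - lambda_max X) 1
    \<and> \<bar>Im lam\<bar> \<le> sqrt \<gamma>_last * mat_norm2 (1\<^sub>m n - X)"
proof -
  note m_le_n = assms(1) and A = assms(3)
  define H where "H = Q + \<Theta>1"
  define g where "g i = H $$ (i, i)" for i
  have pdH: "sym_pd n H" unfolding H_def by (rule sym_pd_psd_add[OF assms(2,6)])
  then have H: "H \<in> carrier_mat n n" "H\<^sup>T = H" by (auto simp: sym_pd_def)
  have g: "g i > 0" if "i < n" for i using sym_pd_diagonal_pos[OF pdH that] by (simp add: g_def)
  have G: "G = mat_diag n g" unfolding assms(12) diag_part_def g_def H_def[symmetric] using H by simp
  define j where "j i = J $$ (i, i)" for i
  have Jc: "J \<in> carrier_mat n n" using assms(15) by (simp add: sym_pd_def)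
  have J: "J = mat_diag n j" unfolding j_def by (rule diagonal_mat_eq_mat_diag[OF assms(14) Jc])
  have j: "j i > 0" if "i < n" for i using sym_pd_diagonal_pos[OF assms(15) that] by (simp add: j_def)
  define p where "p i = \<Theta>2 $$ (i, i)" for i
  define q where "q i = \<Theta>2upd $$ (i, i)" for i
  have \<Theta>c: "\<Theta>2 \<in> carrier_mat m m" "\<Theta>2\<^sup>T = \<Theta>2" "\<Theta>2upd \<in> carrier_mat m m"
    using assms(8,17) by (auto simp: sym_psd_def)
  have \<Theta>: "\<Theta>2 = mat_diag m p" "\<Theta>2upd = mat_diag m q"
    unfolding p_def q_def using diagonal_mat_eq_mat_diag assms(7,16) \<Theta>c by blast+
  have pq: "p i \<ge> 0" "q i \<ge> 0" if "i < m" for i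
    using sym_psd_diagonal_nonneg[OF assms(8) that] sym_psd_diagonal_nonneg[OF assms(17) that]
    by (simp_all add: p_def q_def)
  have L: "L \<subseteq> {..<m}" using assms(10) by auto
  have p0: "p i = 0" if "i < m" "i \<notin> L" for i using that assms(10) by (auto simp: p_def)
  have q0: "q i = 0" if "i < m" "i \<notin> L" for i using that assms(18) by (auto simp: q_def)
  have pL: "p i > 0" if "i \<in> L" for i
    using that assms(10) pq(1)[of i] by (auto simp: p_def less_le)
  have qL: "q i > 0" if "i \<in> L" for i
    using that assms(18) pq(2)[of i] by (auto simp: q_def less_le)
  \<comment> \<open>A nonzero matrix has positive dimension; so all spectra below are nonempty and
    their minima and maxima are meaningful.\<close>
  have "m \<noteq> 0" using assms(9) \<Theta>c(1) by (auto intro!: eq_matI)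
  then have m: "0 < m" and n: "0 < n" using m_le_n by auto
  have inj: "y = 0\<^sub>v m" if "y \<in> carrier_vec m" "A\<^sup>T *\<^sub>v y = 0\<^sub>v n" for y
    using full_row_rank_transpose_injective[OF A _ that] assms(4) m_le_n by simp

  define D where "D = mat_inv G"
  have pdG: "sym_pd n G" unfolding G using g by (rule sym_pd_mat_diag)
  then have Gc: "G \<in> carrier_mat n n" "G\<^sup>T = G" by (auto simp: sym_pd_def)
  note D = mat_inv_correct[OF Gc(1) sym_pd_det_nonzero[OF pdG], folded D_def]
  have S_eq: "S = A * mat_inv (mat_diag n g) * A\<^sup>T + mat_diag m p"
    unfolding assms(13) G \<Theta>(1) ..
  have Supd_eq: "Supd = A * mat_inv (mat_diag n j) * A\<^sup>T + mat_diag m q"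
    unfolding assms(19) J \<Theta>(2) ..
  have pdS: "sym_pd m Supd"
    unfolding Supd_eq using j pq(2) inj by (intro schur_complement_pd[OF A]) auto
  then have Supd: "Supd \<in> carrier_mat m m" "Supd\<^sup>T = Supd" by (auto simp: sym_pd_def)
  have S: "S \<in> carrier_mat m m" "S\<^sup>T = S"
    unfolding S_eq using schur_complement_form(1,2)[OF A] g by auto

  have diag: "set (diag_mat (Jt * mat_inv Gt)) = (\<lambda>i. j i / g i) ` {..<n} \<union> (\<lambda>i. p i / q i) ` L"
    unfolding assms(11,22,23) G J \<Theta> using augmented_diagonal_quotient[OF L g j pL qL] by simp
  have \<gamma>: "\<gamma>_first \<le> r \<and> r \<le> \<gamma>_last" if "r \<in> (\<lambda>i. j i / g i) ` {..<n} \<union> (\<lambda>i. p i / q i) ` L" for r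
    using that unfolding assms(24,25) min_diag_def max_diag_def diag[symmetric] by simp
  have compare: "\<gamma>_first * (y \<bullet> (Supd *\<^sub>v y)) \<le> y \<bullet> (S *\<^sub>v y)"
    "y \<bullet> (S *\<^sub>v y) \<le> \<gamma>_last * (y \<bullet> (Supd *\<^sub>v y))" if "y \<in> carrier_vec m" for y
    unfolding S_eq Supd_eq
    using schur_complement_compare[where a = g and b = j and p = p and q = q and L = L
        and lo = \<gamma>_first and up = \<gamma>_last, OF A that] g j L pL qL p0 q0 \<gamma> by auto
  have \<gamma>pos: "0 < \<gamma>_last"
    using \<gamma>[of "j 0 / g 0"] n g[of 0] j[of 0] by (force intro: less_le_trans[of 0 "j 0 / g 0"])

  define F where "F = mat_diag n (\<lambda>i. sqrt (g i))"
  have F: "F \<in> carrier_mat n n" by (simp add: F_def)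
  have X_eq: "X = diag_inv_sqrt (mat_diag n g) * H * diag_inv_sqrt (mat_diag n g)"
    unfolding assms(26) G H_def ..
  note scaling = diagonal_scaling[where g = g, OF H g, folded F_def X_eq G]
  have X: "X \<in> carrier_mat n n" "X\<^sup>T = X" using scaling(1,2) g by auto
  define l1 where "l1 = lambda_min X"
  define u1 where "u1 = lambda_max X"
  have one: "sym_pd n (1\<^sub>m n)" using sym_pd_mat_diag[of n "\<lambda>_. 1"] by simp
  have H_bounds: "l1 * (w \<bullet> (G *\<^sub>v w)) \<le> w \<bullet> (H *\<^sub>v w)" "w \<bullet> (H *\<^sub>v w) \<le> u1 * (w \<bullet> (G *\<^sub>v w))"
    if w: "w \<in> carrier_vec n" for w
  proof -
    have Fw: "F *\<^sub>v w \<in> carrier_vec n" using F w by auto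
    show "l1 * (w \<bullet> (G *\<^sub>v w)) \<le> w \<bullet> (H *\<^sub>v w)" "w \<bullet> (H *\<^sub>v w) \<le> u1 * (w \<bullet> (G *\<^sub>v w))"
      using pencil_lambda_min(1)[OF n X(1) one _ Fw] pencil_lambda_max(1)[OF n X(1) one _ Fw] X Fw w
        scaling(3,4) g by (simp_all add: l1_def u1_def)
  qed
  \<comment> \<open>This is where definiteness of \<open>2 I - X\<close> enters, evaluated at an
    eigenvector for \<open>u1\<close>; it makes the lower factor \<open>b2\<close> positive, so
    multiplying by it preserves inequalities.\<close>
  have u1: "u1 < 2"
  proof -
    obtain v where ev: "eigenvector X v u1"
      using pencil_lambda_max(2)[OF n X(1) one] X by (auto simp: u1_def)
    then have v: "v \<in> carrier_vec n" "v \<noteq> 0\<^sub>v n" "X *\<^sub>v v = u1 \<cdot>\<^sub>v v" using X by (auto simp: eigenvector_def)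
    have "0 < v \<bullet> ((2 \<cdot>\<^sub>m 1\<^sub>m n - X) *\<^sub>v v)" using assms(27) v by (simp add: sym_pd_def)
    also have "(2 \<cdot>\<^sub>m 1\<^sub>m n - X) *\<^sub>v v = 2 \<cdot>\<^sub>v v - u1 \<cdot>\<^sub>v v"
      using v X by (subst minus_mult_distrib_mat_vec[of _ n n]) (auto simp: smult_mat_mult_vec[of _ n n])
    also have "v \<bullet> (2 \<cdot>\<^sub>v v - u1 \<cdot>\<^sub>v v) = (2 - u1) * (v \<bullet> v)"
      using v by (simp add: scalar_prod_minus_distrib[of _ n] algebra_simps)
    finally show ?thesis using scalar_prod_self_nonneg[of v] by (simp add: zero_less_mult_iff)
  qed

  define Z where "Z = mat_inv Supd * S"
  note invS = mat_inv_correct[OF Supd(1) sym_pd_det_nonzero[OF pdS]]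
  \<comment> \<open>\<open>Z\<close> need not be symmetric, but \<open>Supd * Z\<close> is the
    symmetric \<open>S\<close>, so the pencil results apply with \<open>Supd\<close> as the definite
    matrix.\<close>
  have Z: "Z \<in> carrier_mat m m" "Supd * Z = S"
    using invS S Supd assoc_mult_mat[OF Supd(1) invS(1) S(1)] by (auto simp: Z_def)
  have Zsym: "(Supd * Z)\<^sup>T = Supd * Z" using Z S by simp
  define a2 where "a2 = max (2 - l1) 1"
  define b2 where "b2 = min (2 - u1) 1"
  have a2: "0 < a2" and b2: "0 < b2" using u1 by (auto simp: a2_def b2_def)
  have lam_up: "lam_up = lambda_max Z * a2" and lam_lo: "lam_lo = lambda_min Z * b2"
    unfolding assms(28,29) Z_def a2_def b2_def l1_def u1_def by simp_all
  \<comment> \<open>The comparison of the two Schur complements, read at an eigenvector attaining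
    the extreme eigenvalue.\<close>
  have "lambda_max Z \<le> \<gamma>_last"
  proof -
    obtain v where "eigenvector Z v (lambda_max Z)" using pencil_lambda_max(2)[OF m Z(1) pdS Zsym] by blast
    from pencil_form_eigenvector[OF Z(1) pdS this] compare(2)[of v] show ?thesis
      unfolding Z(2) by (metis mult_le_cancel_right_pos)
  qed
  then have up_le: "lam_up \<le> \<gamma>_last * a2" unfolding lam_up using a2 by simp
  have "\<gamma>_first \<le> lambda_min Z"
  proof -
    obtain v where "eigenvector Z v (lambda_min Z)" using pencil_lambda_min(2)[OF m Z(1) pdS Zsym] by blast
    from pencil_form_eigenvector[OF Z(1) pdS this] compare(1)[of v] show ?thesis
      unfolding Z(2) by (metis mult_le_cancel_right_pos)
  qed
  then have lo_ge: "\<gamma>_first * b2 \<le> lam_lo" unfolding lam_lo using b2 by simp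

  define k where "k y = D *\<^sub>v (A\<^sup>T *\<^sub>v y)" for y
  have k: "k y \<in> carrier_vec n" "G *\<^sub>v k y = A\<^sup>T *\<^sub>v y"
    "y \<bullet> (S *\<^sub>v y) = k y \<bullet> (G *\<^sub>v k y) + y \<bullet> (\<Theta>2 *\<^sub>v y)" if y: "y \<in> carrier_vec m" for y
  proof -
    have z: "A\<^sup>T *\<^sub>v y \<in> carrier_vec n" using A y by auto
    show ky: "k y \<in> carrier_vec n" using D z by (auto simp: k_def)
    show Gk: "G *\<^sub>v k y = A\<^sup>T *\<^sub>v y"
      unfolding k_def using assoc_mult_mat_vec[OF Gc(1) D(1) z] D z by simp
    show "y \<bullet> (S *\<^sub>v y) = k y \<bullet> (G *\<^sub>v k y) + y \<bullet> (\<Theta>2 *\<^sub>v y)"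
      using schur_complement_form(3)[where t = p and f = g, OF A g y, folded S_eq G \<Theta>(1), folded D_def]
        comm_scalar_prod[OF z ky] unfolding Gk by (simp add: k_def)
  qed
  have forms_nonneg: "0 \<le> w \<bullet> (G *\<^sub>v w)" "0 \<le> y \<bullet> (Supd *\<^sub>v y)" "0 \<le> y \<bullet> (\<Theta>2 *\<^sub>v y)"
    if "w \<in> carrier_vec n" "y \<in> carrier_vec m" for w y
    using that sym_pd_imp_psd[OF pdG] sym_pd_imp_psd[OF pdS] assms(8) by (auto simp: sym_psd_def)
  have t_bounds: "lam_lo * (y \<bullet> (Supd *\<^sub>v y)) \<le> 2 * (k y \<bullet> (G *\<^sub>v k y)) - k y \<bullet> (H *\<^sub>v k y) + y \<bullet> (\<Theta>2 *\<^sub>v y)"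
    "2 * (k y \<bullet> (G *\<^sub>v k y)) - k y \<bullet> (H *\<^sub>v k y) + y \<bullet> (\<Theta>2 *\<^sub>v y) \<le> lam_up * (y \<bullet> (Supd *\<^sub>v y))"
    if y: "y \<in> carrier_vec m" for y
  proof -
    define r where "r = k y \<bullet> (G *\<^sub>v k y)"
    define \<theta> where "\<theta> = y \<bullet> (\<Theta>2 *\<^sub>v y)"
    have nn: "0 \<le> r" "0 \<le> \<theta>" using forms_nonneg[OF k(1)[OF y] y] by (simp_all add: r_def \<theta>_def)
    have h: "l1 * r \<le> k y \<bullet> (H *\<^sub>v k y)" "k y \<bullet> (H *\<^sub>v k y) \<le> u1 * r"
      using H_bounds[OF k(1)[OF y]] by (simp_all add: r_def)
    have Sy: "y \<bullet> (S *\<^sub>v y) = r + \<theta>" using k(3)[OF y] by (simp add: r_def \<theta>_def)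
    have rq: "lambda_min Z * (y \<bullet> (Supd *\<^sub>v y)) \<le> r + \<theta>" "r + \<theta> \<le> lambda_max Z * (y \<bullet> (Supd *\<^sub>v y))"
      using pencil_lambda_min(1)[OF m Z(1) pdS Zsym y] pencil_lambda_max(1)[OF m Z(1) pdS Zsym y]
      unfolding Z(2) Sy by auto
    \<comment> \<open>Both weights, the one between \<open>2 - u1\<close> and \<open>2 - l1\<close>
      on \<open>r\<close> and the weight 1 on \<open>\<theta>\<close>, lie between \<open>b2\<close>
      and \<open>a2\<close>. The total is thus compared with \<open>r + \<theta>\<close>, the form
      of \<open>S\<close>.\<close>
    have "b2 * r \<le> (2 - u1) * r" "b2 * \<theta> \<le> 1 * \<theta>" "(2 - l1) * r \<le> a2 * r" "1 * \<theta> \<le> a2 * \<theta>"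
      unfolding a2_def b2_def by (rule mult_right_mono; use nn in simp)+
    then have 1: "b2 * (r + \<theta>) \<le> 2 * r - k y \<bullet> (H *\<^sub>v k y) + \<theta>"
      "2 * r - k y \<bullet> (H *\<^sub>v k y) + \<theta> \<le> a2 * (r + \<theta>)"
      using h by (simp_all add: algebra_simps)
    have 2: "lam_lo * (y \<bullet> (Supd *\<^sub>v y)) \<le> b2 * (r + \<theta>)" "a2 * (r + \<theta>) \<le> lam_up * (y \<bullet> (Supd *\<^sub>v y))"
      using mult_left_mono[OF rq(1), of b2] mult_left_mono[OF rq(2), of a2] a2 b2
      by (simp_all add: lam_up lam_lo mult_ac)
    show "lam_lo * (y \<bullet> (Supd *\<^sub>v y)) \<le> 2 * (k y \<bullet> (G *\<^sub>v k y)) - k y \<bullet> (H *\<^sub>v k y) + y \<bullet> (\<Theta>2 *\<^sub>v y)"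
      "2 * (k y \<bullet> (G *\<^sub>v k y)) - k y \<bullet> (H *\<^sub>v k y) + y \<bullet> (\<Theta>2 *\<^sub>v y) \<le> lam_up * (y \<bullet> (Supd *\<^sub>v y))"
      using 1 2 by (simp_all add: r_def \<theta>_def)
  qed
  define K where "K = sqrt \<gamma>_last * mat_norm2 (1\<^sub>m n - X)"
  have IX: "1\<^sub>m n - X \<in> carrier_mat n n" using X by (intro minus_carrier_mat)
  note norm_nonneg = mat_norm2_nonneg[OF IX n]
  have coupling: "2 * \<bar>w \<bullet> (H *\<^sub>v k y) - w \<bullet> (G *\<^sub>v k y)\<bar> \<le> K * (w \<bullet> (G *\<^sub>v w) + y \<bullet> (Supd *\<^sub>v y))"
    if w: "w \<in> carrier_vec n" and y: "y \<in> carrier_vec m" for w y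
  proof -
    define \<sigma> where "\<sigma> = y \<bullet> (Supd *\<^sub>v y)"
    have Fc: "F *\<^sub>v w \<in> carrier_vec n" "F *\<^sub>v k y \<in> carrier_vec n" using F w k(1)[OF y] by auto
    have Xc: "X *\<^sub>v (F *\<^sub>v k y) \<in> carrier_vec n" using X Fc by auto
    have "w \<bullet> (G *\<^sub>v k y) - w \<bullet> (H *\<^sub>v k y) = (F *\<^sub>v w) \<bullet> ((1\<^sub>m n - X) *\<^sub>v (F *\<^sub>v k y))"
      using scaling(3,4)[OF _ w k(1)[OF y]] g Fc Xc X
      by (simp add: minus_mult_distrib_mat_vec[of _ n n] scalar_prod_minus_distrib[of _ n])
    then have "\<bar>w \<bullet> (H *\<^sub>v k y) - w \<bullet> (G *\<^sub>v k y)\<bar> = \<bar>(F *\<^sub>v w) \<bullet> ((1\<^sub>m n - X) *\<^sub>v (F *\<^sub>v k y))\<bar>"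
      by (simp add: abs_minus_commute)
    also have "\<dots> \<le> vec_norm2 (F *\<^sub>v w) * vec_norm2 ((1\<^sub>m n - X) *\<^sub>v (F *\<^sub>v k y))"
      using Fc IX by (intro scalar_prod_Cauchy_Schwarz) auto
    also have "\<dots> \<le> vec_norm2 (F *\<^sub>v w) * (mat_norm2 (1\<^sub>m n - X) * vec_norm2 (F *\<^sub>v k y))"
      by (intro mult_left_mono mat_norm2_upper[OF IX Fc(2)] vec_norm2_nonneg)
    \<comment> \<open>Dropping the nonnegative form of \<open>\<Theta>2\<close> leaves the form of
      \<open>S\<close>, and comparison with \<open>Supd\<close> costs the factor
      \<open>\<gamma>_last\<close>; its root appears because a norm is bounded here, not a
      square.\<close>
    also have "vec_norm2 (F *\<^sub>v k y) \<le> sqrt \<gamma>_last * sqrt \<sigma>"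
    proof -
      have "(F *\<^sub>v k y) \<bullet> (F *\<^sub>v k y) = k y \<bullet> (G *\<^sub>v k y)"
        using scaling(4)[OF _ k(1)[OF y] k(1)[OF y]] g by simp
      also have "\<dots> \<le> y \<bullet> (S *\<^sub>v y)" using k(3)[OF y] forms_nonneg(3)[OF w y] by simp
      also have "\<dots> \<le> \<gamma>_last * \<sigma>" using compare(2)[OF y] by (simp add: \<sigma>_def)
      finally show ?thesis by (simp add: vec_norm2_def flip: real_sqrt_mult)
    qed
    finally have "\<bar>w \<bullet> (H *\<^sub>v k y) - w \<bullet> (G *\<^sub>v k y)\<bar>
        \<le> vec_norm2 (F *\<^sub>v w) * (mat_norm2 (1\<^sub>m n - X) * (sqrt \<gamma>_last * sqrt \<sigma>))"
      using norm_nonneg vec_norm2_nonneg by (simp add: mult_left_mono)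
    also have "\<dots> = K * (vec_norm2 (F *\<^sub>v w) * sqrt \<sigma>)" by (simp add: K_def)
    finally have "2 * \<bar>w \<bullet> (H *\<^sub>v k y) - w \<bullet> (G *\<^sub>v k y)\<bar> \<le> K * (2 * vec_norm2 (F *\<^sub>v w) * sqrt \<sigma>)"
      by simp
    \<comment> \<open>The arithmetic-geometric mean inequality turns the product into the sum of
      squares, hence into the form of \<open>G\<close> plus that of \<open>Supd\<close>.\<close>
    also have "\<dots> \<le> K * ((vec_norm2 (F *\<^sub>v w))\<^sup>2 + (sqrt \<sigma>)\<^sup>2)"
      using norm_nonneg \<gamma>pos by (intro mult_left_mono sum_squares_bound) (simp add: K_def)
    also have "(vec_norm2 (F *\<^sub>v w))\<^sup>2 = w \<bullet> (G *\<^sub>v w)"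
      using scaling(4)[OF _ w w] g by (simp add: vec_norm2_square)
    also have "(sqrt \<sigma>)\<^sup>2 = \<sigma>" using forms_nonneg(2)[OF w y] by (simp add: \<sigma>_def)
    finally show ?thesis by (simp add: \<sigma>_def)
  qed

  define P where "P = four_block_mat G A\<^sup>T A (A * D * A\<^sup>T - Supd)"
  have \<A>: "\<A> = four_block_mat H A\<^sup>T A (- \<Theta>2)" unfolding assms(20) H_def ..
  note prec = indefinite_preconditioner[OF Gc(1) D A Supd(1) sym_pd_det_nonzero[OF pdS],
      folded P_def, unfolded D_def, folded assms(21)]
  have Pc: "P \<in> carrier_mat (n + m) (n + m)" and \<A>c: "\<A> \<in> carrier_mat (n + m) (n + m)"
    using Gc H A D Supd \<Theta>c by (auto simp: P_def \<A>)
  define W where "W = mat_inv P * \<A>"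
  have "det P \<noteq> 0" "Pupd = P" using prec by auto
  note invP = mat_inv_correct[OF Pc this(1)]
  \<comment> \<open>Clearing the inverse: from here on the eigenvalue equation is a generalized one,
    between the saddle point matrix and \<open>P\<close>.\<close>
  have W: "W \<in> carrier_mat (n + m) (n + m)" "P * W = \<A>"
    using invP \<A>c assoc_mult_mat[OF Pc invP(1) \<A>c] by (auto simp: W_def)
  have ev: "eigenvector (map_mat complex_of_real W) (x @\<^sub>v y) lam"
    using assms(32) unfolding W_def \<open>Pupd = P\<close> .
  define x1 where "x1 = map_vec Re x"
  define x2 where "x2 = map_vec Im x"
  define y1 where "y1 = map_vec Re y"
  define y2 where "y2 = map_vec Im y"
  have xy: "x1 \<in> carrier_vec n" "x2 \<in> carrier_vec n" "y1 \<in> carrier_vec m" "y2 \<in> carrier_vec m"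
    using assms(30,31) by (simp_all add: x1_def x2_def y1_def y2_def)
  have "map_vec Re (x @\<^sub>v y) = x1 @\<^sub>v y1" "map_vec Im (x @\<^sub>v y) = x2 @\<^sub>v y2"
    by (auto simp: x1_def x2_def y1_def y2_def intro!: eq_vecI)
  note WReIm = eigenvector_Re_Im[OF W(1) ev, unfolded this]
  have uc: "x1 @\<^sub>v y1 \<in> carrier_vec (n + m)" "x2 @\<^sub>v y2 \<in> carrier_vec (n + m)" using xy by auto
  have PW: "\<A> *\<^sub>v u = P *\<^sub>v (W *\<^sub>v u)" if "u \<in> carrier_vec (n + m)" for u
    using assoc_mult_mat_vec[OF Pc W(1) that] W(2) by simp
  have Re: "\<A> *\<^sub>v (x1 @\<^sub>v y1) = Re lam \<cdot>\<^sub>v (P *\<^sub>v (x1 @\<^sub>v y1)) - Im lam \<cdot>\<^sub>v (P *\<^sub>v (x2 @\<^sub>v y2))"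
    using uc Pc by (simp add: PW WReIm mult_minus_distrib_mat_vec[of _ "n + m" "n + m"] mult_mat_vec[of _ "n + m" "n + m"])
  have Im: "\<A> *\<^sub>v (x2 @\<^sub>v y2) = Re lam \<cdot>\<^sub>v (P *\<^sub>v (x2 @\<^sub>v y2)) + Im lam \<cdot>\<^sub>v (P *\<^sub>v (x1 @\<^sub>v y1))"
    using uc Pc by (simp add: PW WReIm mult_add_distrib_mat_vec[of _ "n + m" "n + m"] mult_mat_vec[of _ "n + m" "n + m"])
  define w1 where "w1 = x1 + k y1"
  define w2 where "w2 = x2 + k y2"
  have w: "w1 \<in> carrier_vec n" "w2 \<in> carrier_vec n" using xy k by (auto simp: w1_def w2_def)
  define gg where "gg = w1 \<bullet> (G *\<^sub>v w1) + w2 \<bullet> (G *\<^sub>v w2)"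
  define s where "s = y1 \<bullet> (Supd *\<^sub>v y1) + y2 \<bullet> (Supd *\<^sub>v y2)"
  define c where "c = w1 \<bullet> (H *\<^sub>v k y2) - w1 \<bullet> (G *\<^sub>v k y2) - (w2 \<bullet> (H *\<^sub>v k y1) - w2 \<bullet> (G *\<^sub>v k y1))"
  define h where "h = w1 \<bullet> (H *\<^sub>v w1) + w2 \<bullet> (H *\<^sub>v w2)"
  define t where "t = (2 * (k y1 \<bullet> (G *\<^sub>v k y1)) - k y1 \<bullet> (H *\<^sub>v k y1) + y1 \<bullet> (\<Theta>2 *\<^sub>v y1))
      + (2 * (k y2 \<bullet> (G *\<^sub>v k y2)) - k y2 \<bullet> (H *\<^sub>v k y2) + y2 \<bullet> (\<Theta>2 *\<^sub>v y2))"
  note ids = saddle_point_identities[OF H Gc D(1,2) A \<Theta>c(1,2) Supd xy, of "Re lam" "Im lam",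
      folded \<A> P_def k_def, OF Re Im, folded w1_def w2_def, folded gg_def s_def c_def]
  have re: "Re lam * (gg + s) = h + t" using ids(1) by (simp add: h_def t_def)
  \<comment> \<open>Definiteness of \<open>Supd\<close> translates the case distinction on
    \<open>y\<close> into one on the scalar \<open>s\<close>.\<close>
  have s0: "s = 0 \<longleftrightarrow> y = 0\<^sub>v m"
  proof
    assume "s = 0"
    then have "y1 \<bullet> (Supd *\<^sub>v y1) = 0" "y2 \<bullet> (Supd *\<^sub>v y2) = 0"
      using forms_nonneg(2)[OF w(1) xy(3)] forms_nonneg(2)[OF w(1) xy(4)] by (simp_all add: s_def)
    then have "y1 = 0\<^sub>v m" "y2 = 0\<^sub>v m" using pdS xy by (metis less_irrefl sym_pd_def)+
    then have "y1 $ i = 0" "y2 $ i = 0" if "i < m" for i using that by simp_all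
    then show "y = 0\<^sub>v m"
      using assms(31) by (auto simp: y1_def y2_def complex_eq_iff intro!: eq_vecI)
  next
    assume "y = 0\<^sub>v m"
    then have "y1 = 0\<^sub>v m" "y2 = 0\<^sub>v m" by (auto simp: y1_def y2_def intro!: eq_vecI)
    then show "s = 0" using Supd by (simp add: s_def)
  qed
  have nonneg: "0 \<le> gg" "0 \<le> s"
    using forms_nonneg[OF w(1) xy(3)] forms_nonneg[OF w(2) xy(4)] by (simp_all add: gg_def s_def)
  \<comment> \<open>If the sum vanished, then \<open>y = 0\<close>, so \<open>k\<close> vanishes and
    \<open>w\<close> is just \<open>x\<close>, which is then 0 by definiteness of \<open>G\<close>;
    an eigenvector is not zero.\<close>
  have pos: "0 < gg + s"
  proof (rule ccontr)
    assume "\<not> 0 < gg + s"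
    then have "gg = 0" "s = 0" using nonneg by auto
    then have y0: "y = 0\<^sub>v m" using s0 by simp
    then have "y1 = 0\<^sub>v m" "y2 = 0\<^sub>v m" by (auto simp: y1_def y2_def intro!: eq_vecI)
    moreover have "k (0\<^sub>v m) = 0\<^sub>v n"
    proof -
      have "A\<^sup>T *\<^sub>v 0\<^sub>v m = 0\<^sub>v n" "D *\<^sub>v 0\<^sub>v n = 0\<^sub>v n" using A D by (auto intro!: eq_vecI)
      then show ?thesis by (simp add: k_def)
    qed
    ultimately have "w1 = x1" "w2 = x2" using xy by (simp_all add: w1_def w2_def)
    moreover have "w1 \<bullet> (G *\<^sub>v w1) = 0" "w2 \<bullet> (G *\<^sub>v w2) = 0"
      using \<open>gg = 0\<close> forms_nonneg(1)[OF w(1) xy(3)] forms_nonneg(1)[OF w(2) xy(3)] by (simp_all add: gg_def)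
    then have "w1 = 0\<^sub>v n" "w2 = 0\<^sub>v n" using pdG w by (metis less_irrefl sym_pd_def)+
    ultimately have "x1 = 0\<^sub>v n" "x2 = 0\<^sub>v n" by metis+
    then have "x1 $ i = 0" "x2 $ i = 0" if "i < n" for i using that by simp_all
    then have "x = 0\<^sub>v n"
      using assms(30) by (auto simp: x1_def x2_def complex_eq_iff intro!: eq_vecI)
    with y0 have "x @\<^sub>v y = 0\<^sub>v (n + m)" by (auto intro!: eq_vecI)
    with ev W(1) show False by (simp add: eigenvector_def)
  qed
  have h: "l1 * gg \<le> h" "h \<le> u1 * gg"
    using H_bounds[OF w(1)] H_bounds[OF w(2)] by (simp_all add: gg_def h_def distrib_left)
  have t: "lam_lo * s \<le> t" "t \<le> lam_up * s"
    unfolding s_def t_def distrib_left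
    by (intro add_mono t_bounds xy)+
  \<comment> \<open>\<open>c\<close> is the difference of two couplings, \<open>w1\<close> with
    \<open>y2\<close> and \<open>w2\<close> with \<open>y1\<close>. Each vector occurs once, so the
    two bounds add up to exactly \<open>K * (gg + s)\<close>.\<close>
  have "2 * \<bar>a - b\<bar> \<le> r1 + r2" if "2 * \<bar>a\<bar> \<le> r1" "2 * \<bar>b\<bar> \<le> r2" for a b r1 r2 :: real
  proof -
    have "2 * \<bar>a - b\<bar> \<le> 2 * (\<bar>a\<bar> + \<bar>b\<bar>)"
      by (rule mult_left_mono[OF abs_triangle_ineq4]) simp
    also have "\<dots> \<le> r1 + r2" using add_mono[OF that] by (simp only: distrib_left)
    finally show ?thesis .
  qed
  from this[OF coupling[OF w(1) xy(4)] coupling[OF w(2) xy(3)]]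
  have c: "2 * \<bar>c\<bar> \<le> K * (gg + s)"
    unfolding c_def gg_def s_def by (simp only: distrib_left ac_simps)
  note bounds = two_component_bounds[OF nonneg pos re ids(2,3) h t c]
  show ?thesis
    unfolding l1_def[symmetric] u1_def[symmetric] a2_def[symmetric] b2_def[symmetric] K_def[symmetric]
    using bounds s0 up_le lo_ge by blast
qed

end
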